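(* Let $A \in \mathbb{R}^{m \times n}$, let $1 \le p \le k$ be integers, and let $\hat\Theta_{2p} = \binom{k}{p}\hat\theta_{2p}$, where $\hat\theta_{2p}$ is the estimator of $\|A\|_{2p}^{2p}$ built from a Gaussian sketch of $A$ with sketch size $k$ (defined in the context). Then \begin{align*} \mathrm{Var}(\hat\Theta_{2p}) & \le - \binom{k}{p}^2\|A\|_{2p}^{4p} + \binom{k}{2p} \binom{2p}{p} \|A\|_{2p}^{4p} + \binom{k}{2p-1}\binom{2p-1}{p}\, p \left( \|A\|_{2p}^{4p} + 2 \|A\|_{4p}^{4p} \right) \\ &\quad + \binom{k}{2p-2}\binom{2p-2}{p}\binom{p}{2} \left( 6 \|A\|_{4p}^{4p} + 3 \|A\|_4^4\|A\|_{4p-4}^{4p-4}\right) \\ &\quad + \sum_{r=3}^p \binom{k}{2p-r}\binom{2p-r}{p}\binom{p}{r} \sum_{\ell = 1}^r c(r,\ell)\, \|A\|_4^{4(\ell-1)} \|A\|_{4p-4(\ell-1)}^{4p-4(\ell-1)}, \end{align*} where $$c(r,\ell) = \begin{cases} 3^r & \text{if } \ell=1;\\ 3^{r-2}(2^{r+1}-1) & \text{if } \ell = 2;\\ 3^{r-\ell}\, \ell^r &\text{otherwise.}\end{cases}$$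
   Context: For a real matrix $A$ with singular values $\sigma_1,\dots,\sigma_{\min\{m,n\}}$ and an integer $q\ge 1$, the Schatten-$q$ norm is $\|A\|_q = \left(\sum_i \sigma_i^q\right)^{1/q}$. Binomial coefficients $\binom{a}{b}$ with $b>a\ge 0$ are zero (so for $p=1$ the term containing $\binom{p}{2}$ is zero and the sum over $r$ is empty). Estimator: let $\Omega \in \mathbb{R}^{n\times k}$ be a random matrix with i.i.d. standard Gaussian $N(0,1)$ entries, $Y = A\Omega$, $Z = Y^TY \in \mathbb{R}^{k\times k}$, and let $T$ be the strictly upper triangular part of $Z$ (entries on and below the diagonal set to zero). Then $$\hat\theta_{2p} = \binom{k}{p}^{-1}\mathrm{trace}(T^{p-1}Z),$$ with $T^0 = I$. Equivalently, $\hat\theta_{2p} = \binom{k}{p}^{-1}\sum_{1\le i_1<\cdots<i_p\le k} Z_{i_1 i_2}Z_{i_2i_3}\cdots Z_{i_{p-1}i_p}Z_{i_pi_1}$. The variance is over the randomness of $\Omega$. *)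

theory Defs
  imports
    "HOL-Probability.Probability"
    "Jordan_Normal_Form.Char_Poly"
begin

hide_const (open) Finite_Cartesian_Product.mat Finite_Cartesian_Product.vec
hide_type (open) Finite_Cartesian_Product.vec

text \<open>
  The \<open>min m n\<close> singular values of an \<open>m \<times> n\<close> matrix, with multiplicity: the square roots
  of the eigenvalues of the smaller of the two Gram matrices. Being symmetric and positive
  semidefinite, it has a characteristic polynomial that splits over the reals with nonnegative
  roots, so the multiset \<open>proots\<close> contains all its eigenvalues.
\<close>

definition singular_values :: "real mat \<Rightarrow> real multiset" where
  "singular_values A =
     image_mset sqrt (proots (char_poly
       (if dim_col A \<le> dim_row A then transpose_mat A * A else A * transpose_mat A)))"

definition schatten_norm :: "nat \<Rightarrow> real mat \<Rightarrow> real" where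
  "schatten_norm q A = root q (\<Sum>\<sigma>\<in>#singular_values A. \<sigma> ^ q)"

definition mat_trace :: "real mat \<Rightarrow> real" where
  "mat_trace A = (\<Sum>i<dim_row A. A $$ (i, i))"

definition strict_upper_part :: "real mat \<Rightarrow> real mat" where
  "strict_upper_part Z =
     mat (dim_row Z) (dim_col Z) (\<lambda>(i, j). if i < j then Z $$ (i, j) else 0)"

definition std_gaussian_mat ::
    "'a measure \<Rightarrow> nat \<Rightarrow> nat \<Rightarrow> ('a \<Rightarrow> real mat) \<Rightarrow> bool" where
  "std_gaussian_mat M n k \<Omega> \<longleftrightarrow>
     (\<forall>\<omega>\<in>space M. \<Omega> \<omega> \<in> carrier_mat n k) \<and>
     (\<forall>i<n. \<forall>j<k. distributed M lborel (\<lambda>\<omega>. \<Omega> \<omega> $$ (i, j)) std_normal_density) \<and>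
     prob_space.indep_vars M (\<lambda>_. borel) (\<lambda>(i, j) \<omega>. \<Omega> \<omega> $$ (i, j)) ({..<n} \<times> {..<k})"

definition sketch_gram :: "real mat \<Rightarrow> real mat \<Rightarrow> real mat" where
  "sketch_gram A W = transpose_mat (A * W) * (A * W)"

text \<open>
  The estimator of \<open>schatten_norm (2 * p) A ^ (2 * p)\<close>, as a function of the realization \<open>W\<close> of
  the sketching matrix; the sketch size is the number of columns of \<open>W\<close>.
\<close>

definition schatten_estimator :: "real mat \<Rightarrow> nat \<Rightarrow> real mat \<Rightarrow> real" where
  "schatten_estimator A p W =
     (let Z = sketch_gram A W
      in mat_trace ((strict_upper_part Z ^\<^sub>m (p - 1)) * Z) / real (dim_col W choose p))"

definition bound_coeff :: "nat \<Rightarrow> nat \<Rightarrow> real" where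
  "bound_coeff r l =
     (if l = 1 then 3 ^ r
      else if l = 2 then 3 ^ (r - 2) * (2 ^ (r + 1) - 1)
      else 3 ^ (r - l) * real l ^ r)"

end

theory Submission
  imports Defs "Jordan_Normal_Form.Schur_Decomposition"
begin

text \<open>
  Write \<open>B = A\<^sup>T A\<close>, \<open>s\<^sub>j = trace (B\<^sup>j)\<close> and let \<open>g\<^sub>i\<close> be the columns of \<open>\<Omega>\<close>. The unnormalized estimator is
  the sum over the \<open>p\<close>-subsets \<open>S\<close> of \<open>{..<k}\<close> of the trace of the ordered product of the matrices
  \<open>g\<^sub>i g\<^sub>i\<^sup>T B\<close>, \<open>i \<in> S\<close>. For two subsets sharing \<open>r\<close> indices, independence of the columns turns the mean
  of the product of the two traces into the trace of a product of mean tensors. A shared column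
  contributes the three Wick pairings of four copies of \<open>g\<^sub>i\<close>, so the mean is a sum of \<open>3\<^sup>r\<close> products of
  numbers \<open>s\<^sub>j\<close>, one factor for each closed loop, with exponents of total \<open>2 p\<close>. If \<open>r \<ge> 2\<close>, all
  exponents are at least \<open>2\<close>, and \<open>s\<^sub>a s\<^sub>c \<le> s\<^sub>2 s\<^bsub>a+c-2\<^esub>\<close> bounds a product of \<open>l\<close> factors by
  \<open>s\<^sub>2\<^bsup>l-1\<^esup> s\<^bsub>2p-2(l-1)\<^esub>\<close>; it remains to count the pairings with \<open>l\<close> loops and the pairs of subsets.
\<close>

section \<open>Wick contractions of powers of a symmetric matrix\<close>

text \<open>Powers are monotone on nonnegative reals, so \<open>x ^ u - y ^ u\<close> and
  \<open>x ^ v - y ^ v\<close> have the same sign; expanding their product gives the claim.\<close>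

lemma power_pair_rearrangement:
  fixes x y :: real
  assumes "0 \<le> x" "0 \<le> y"
  shows "x ^ u * y ^ v + y ^ u * x ^ v \<le> x ^ (u + v) + y ^ (u + v)"
proof -
  have "0 \<le> (x ^ u - y ^ u) * (x ^ v - y ^ v)"
  proof (cases "x \<le> y")
    case True
    then have "x ^ u \<le> y ^ u" "x ^ v \<le> y ^ v"
      using assms by (auto intro: power_mono)
    then show ?thesis by (simp add: mult_nonpos_nonpos)
  next
    case False
    then have "y ^ u \<le> x ^ u" "y ^ v \<le> x ^ v"
      using assms by (auto intro: power_mono)
    then show ?thesis by simp
  qed
  then show ?thesis by (simp add: algebra_simps power_add)
qed

text \<open>The double sum is symmetrized in \<open>i\<close> and \<open>j\<close>. Each pair then
  has the common factor \<open>\<mu> i ^ 2 * \<mu> j ^ 2\<close>, and the rearrangement inequality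
  applies to the remaining exponents \<open>a - 2\<close> and \<open>c - 2\<close>.\<close>

lemma power_sum_mult_le:
  fixes \<mu> :: "'b \<Rightarrow> real"
  assumes "\<And>i. i \<in> I \<Longrightarrow> 0 \<le> \<mu> i" "2 \<le> a" "2 \<le> c"
  shows "(\<Sum>i\<in>I. \<mu> i ^ a) * (\<Sum>i\<in>I. \<mu> i ^ c) \<le> (\<Sum>i\<in>I. \<mu> i ^ 2) * (\<Sum>i\<in>I. \<mu> i ^ (a + c - 2))"
proof -
  obtain u v where uv: "a = u + 2" "c = v + 2"
    using assms(2,3) by (metis le_add_diff_inverse2)
  have "2 * ((\<Sum>i\<in>I. \<mu> i ^ a) * (\<Sum>i\<in>I. \<mu> i ^ c)) =
      (\<Sum>i\<in>I. \<Sum>j\<in>I. \<mu> i ^ a * \<mu> j ^ c) + (\<Sum>j\<in>I. \<Sum>i\<in>I. \<mu> j ^ a * \<mu> i ^ c)"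
    by (simp add: sum_product)
  also have "\<dots> = (\<Sum>i\<in>I. \<Sum>j\<in>I. (\<mu> i ^ a * \<mu> j ^ c + \<mu> j ^ a * \<mu> i ^ c))"
    by (subst (2) sum.swap) (simp add: sum.distrib)
  also have "\<dots> \<le> (\<Sum>i\<in>I. \<Sum>j\<in>I. (\<mu> i ^ 2 * \<mu> j ^ (a + c - 2) + \<mu> j ^ 2 * \<mu> i ^ (a + c - 2)))"
  proof (intro sum_mono)
    fix i j assume "i \<in> I" "j \<in> I"
    then have "\<mu> i ^ u * \<mu> j ^ v + \<mu> j ^ u * \<mu> i ^ v \<le> \<mu> i ^ (u + v) + \<mu> j ^ (u + v)"
      using assms(1) by (intro power_pair_rearrangement) auto
    then have "(\<mu> i ^ 2 * \<mu> j ^ 2) * (\<mu> i ^ u * \<mu> j ^ v + \<mu> j ^ u * \<mu> i ^ v)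
        \<le> (\<mu> i ^ 2 * \<mu> j ^ 2) * (\<mu> i ^ (u + v) + \<mu> j ^ (u + v))"
      by (intro mult_left_mono) auto
    then show "\<mu> i ^ a * \<mu> j ^ c + \<mu> j ^ a * \<mu> i ^ c \<le>
        \<mu> i ^ 2 * \<mu> j ^ (a + c - 2) + \<mu> j ^ 2 * \<mu> i ^ (a + c - 2)"
      by (simp add: uv algebra_simps power_add power2_eq_square)
  qed
  also have "\<dots> = (\<Sum>i\<in>I. \<Sum>j\<in>I. \<mu> i ^ 2 * \<mu> j ^ (a + c - 2)) +
      (\<Sum>j\<in>I. \<Sum>i\<in>I. \<mu> j ^ 2 * \<mu> i ^ (a + c - 2))"
    by (subst (2) sum.swap) (simp add: sum.distrib)
  also have "\<dots> = 2 * ((\<Sum>i\<in>I. \<mu> i ^ 2) * (\<Sum>i\<in>I. \<mu> i ^ (a + c - 2)))"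
    by (simp add: sum_product)
  finally show ?thesis by simp
qed

section \<open>Tensors with four indices and their contraction along a word\<close>

type_synonym four_tensor = "nat \<Rightarrow> nat \<Rightarrow> nat \<Rightarrow> nat \<Rightarrow> real"

text \<open>The kernel stands for the matrix \<open>B\<close>, extended by zero. Vanishing outside
  the index range makes identities such as \<open>kpow_1\<close> hold between functions on all
  indices, with no range conditions.\<close>

locale symmetric_kernel =
  fixes n :: nat and b :: "nat \<Rightarrow> nat \<Rightarrow> real"
  assumes b_sym: "b x y = b y x"
    and b_outside: "n \<le> x \<Longrightarrow> b x y = 0"
begin

fun kpow :: "nat \<Rightarrow> nat \<Rightarrow> nat \<Rightarrow> real" where
  "kpow 0 x y = of_bool (x = y \<and> x < n)"
| "kpow (Suc j) x y = (\<Sum>z<n. kpow j x z * b z y)"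

lemma kpow_outside_right: "n \<le> y \<Longrightarrow> kpow j x y = 0"
  using b_outside[of y] b_sym[of _ y] by (cases j) auto

lemma kpow_1: "kpow (Suc 0) = b"
proof (intro ext)
  fix x y
  show "kpow (Suc 0) x y = b x y"
    using b_outside by (cases "x < n") (auto simp: sum.delta)
qed

lemma kpow_add: "(\<Sum>z<n. kpow a x z * kpow c z y) = kpow (a + c) x y"
proof (induction c arbitrary: y)
  case 0
  then show ?case
    using kpow_outside_right by (cases "y < n") (auto simp: sum.delta')
next
  case (Suc c)
  have "(\<Sum>z<n. kpow a x z * kpow (Suc c) z y) = (\<Sum>z<n. \<Sum>w<n. kpow a x z * kpow c z w * b w y)"
    by (simp add: sum_distrib_left mult.assoc)
  also have "\<dots> = (\<Sum>w<n. (\<Sum>z<n. kpow a x z * kpow c z w) * b w y)"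
    by (subst sum.swap) (simp add: sum_distrib_right)
  finally show ?case using Suc by simp
qed

lemma kpow_sym: "kpow j x y = kpow j y x"
proof (induction j arbitrary: x y)
  case (Suc j)
  have "kpow (Suc j) x y = (\<Sum>z<n. b y z * kpow j z x)"
    using Suc b_sym by (simp add: mult.commute)
  also have "\<dots> = kpow (1 + j) y x"
    using kpow_add[of 1 y j x] kpow_1 by simp
  finally show ?case by simp
qed auto

definition ktrace :: "nat \<Rightarrow> real" where
  "ktrace j = (\<Sum>x<n. kpow j x x)"

text \<open>
  One factor of the expected product. With \<open>g\<close> a standard Gaussian vector, a letter \<open>(s, s')\<close>
  contracts the pair of column indices of \<open>F\<close> with the mean of \<open>(g g\<^sup>T b)\<^bsup>s\<^esup> \<otimes> (g g\<^sup>T b)\<^bsup>s'\<^esup>\<close>; the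
  three summands for \<open>(True, True)\<close> are the three Wick pairings of four copies of \<open>g\<close>.
\<close>

fun step :: "four_tensor \<Rightarrow> bool \<times> bool \<Rightarrow> four_tensor" where
  "step F (False, False) = F"
| "step F (True, False) = (\<lambda>x y z t. \<Sum>u<n. F x y u t * b u z)"
| "step F (False, True) = (\<lambda>x y z t. \<Sum>v<n. F x y z v * b v t)"
| "step F (True, True) = (\<lambda>x y z t. \<Sum>u<n. \<Sum>v<n. F x y u v *
     (b u z * b v t + b v z * b u t + of_bool (u = v) * (\<Sum>w<n. b w z * b w t)))"

text \<open>In \<open>F x y z t\<close> the pairs \<open>(x, z)\<close> and \<open>(y, t)\<close>
  are the row and column indices of the two products, so the final double sum closes both into
  traces.\<close>

definition run_trace :: "four_tensor \<Rightarrow> (bool \<times> bool) list \<Rightarrow> real" where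
  "run_trace F w = (let G = foldl step F w in \<Sum>x<n. \<Sum>y<n. G x y x y)"

text \<open>These are the three ways of joining four indices by two strands: each product is a
  strand of its own, the columns are exchanged (\<open>form_swap\<close>), or one strand joins the
  two rows and the other the two columns (\<open>form_cap\<close>). The exponents count the copies
  of \<open>b\<close> on a strand. Everything that \<open>step\<close> produces from
  \<open>form_id\<close> is a linear combination of such forms.\<close>

definition form_id :: "nat \<Rightarrow> nat \<Rightarrow> four_tensor" where
  "form_id a c = (\<lambda>x y z t. kpow a x z * kpow c y t)"

definition form_swap :: "nat \<Rightarrow> nat \<Rightarrow> four_tensor" where
  "form_swap a c = (\<lambda>x y z t. kpow a x t * kpow c y z)"

definition form_cap :: "nat \<Rightarrow> nat \<Rightarrow> four_tensor" where
  "form_cap a c = (\<lambda>x y z t. kpow a x y * kpow c z t)"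

definition tensor_add :: "four_tensor \<Rightarrow> four_tensor \<Rightarrow> four_tensor" where
  "tensor_add F G = (\<lambda>x y z t. F x y z t + G x y z t)"

definition tensor_scale :: "real \<Rightarrow> four_tensor \<Rightarrow> four_tensor" where
  "tensor_scale c F = (\<lambda>x y z t. c * F x y z t)"

text \<open>Linearity allows each summand of a contraction to be followed separately along the rest
  of the word.\<close>

lemma step_add: "step (tensor_add F G) l = tensor_add (step F l) (step G l)"
  by (cases "(F, l)" rule: step.cases)
    (auto simp: tensor_add_def fun_eq_iff sum.distrib algebra_simps)

lemma step_scale: "step (tensor_scale c F) l = tensor_scale c (step F l)"
  by (cases "(F, l)" rule: step.cases)
    (auto simp: tensor_scale_def fun_eq_iff sum_distrib_left mult.assoc)

lemma run_trace_Nil: "run_trace F [] = (\<Sum>x<n. \<Sum>y<n. F x y x y)"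
  by (simp add: run_trace_def)

lemma run_trace_Cons: "run_trace F (l # w) = run_trace (step F l) w"
  by (simp add: run_trace_def)

lemma run_trace_add: "run_trace (tensor_add F G) w = run_trace F w + run_trace G w"
  by (induction w arbitrary: F G)
    (simp_all add: run_trace_Nil run_trace_Cons step_add, simp add: tensor_add_def sum.distrib)

lemma run_trace_scale: "run_trace (tensor_scale c F) w = c * run_trace F w"
  by (induction w arbitrary: F)
    (simp_all add: run_trace_Nil run_trace_Cons step_scale, simp add: tensor_scale_def sum_distrib_left)

lemma kpow_mult_kpow_transpose: "(\<Sum>u<n. kpow a x u * kpow c y u) = kpow (a + c) x y"
  using kpow_add[of a x c y] kpow_sym by simp

lemma b_mult_b: "(\<Sum>w<n. b w z * b w t) = kpow 2 z t"
  using kpow_mult_kpow_transpose[of 1 z 1 t] kpow_1 b_sym by (simp add: numeral_2_eq_2)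

text \<open>A column that occurs in one subset only contributes the mean of
  \<open>g g\<^sup>T\<close>, the identity, followed by \<open>b\<close>. So the strand that ends at
  the column index \<open>z\<close> grows by one.\<close>

lemma step_True_False:
  "step (form_id a c) (True, False) = form_id (Suc a) c"
  "step (form_swap a c) (True, False) = form_swap a (Suc c)"
  "step (form_cap a c) (True, False) = form_cap a (Suc c)"
proof -
  show "step (form_id a c) (True, False) = form_id (Suc a) c"
    by (auto simp: form_id_def fun_eq_iff sum_distrib_left sum_distrib_right mult_ac)
  show "step (form_swap a c) (True, False) = form_swap a (Suc c)"
    by (auto simp: form_swap_def fun_eq_iff sum_distrib_left sum_distrib_right mult_ac)
  show "step (form_cap a c) (True, False) = form_cap a (Suc c)"
  proof (intro ext)
    fix x y z t
    have "step (form_cap a c) (True, False) x y z t = kpow a x y * (\<Sum>u<n. kpow c t u * b u z)"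
      using kpow_sym[of c _ t] by (simp add: form_cap_def sum_distrib_left mult_ac)
    then show "step (form_cap a c) (True, False) x y z t = form_cap a (Suc c) x y z t"
      using kpow_sym[of "Suc c" t z] by (simp add: form_cap_def)
  qed
qed

lemma step_False_True:
  "step (form_id a c) (False, True) = form_id a (Suc c)"
  "step (form_swap a c) (False, True) = form_swap (Suc a) c"
  "step (form_cap a c) (False, True) = form_cap a (Suc c)"
  by (auto simp: form_id_def form_swap_def form_cap_def fun_eq_iff
      sum_distrib_left sum_distrib_right mult_ac)

lemma step_True_True:
  "step F (True, True) x y z t =
     (\<Sum>u<n. \<Sum>v<n. F x y u v * (b u z * b v t)) + (\<Sum>u<n. \<Sum>v<n. F x y u v * (b v z * b u t))
     + (\<Sum>u<n. F x y u u) * kpow 2 z t"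
proof -
  have "(\<Sum>u<n. \<Sum>v<n. F x y u v * (of_bool (u = v) * kpow 2 z t)) = (\<Sum>u<n. F x y u u) * kpow 2 z t"
    by (simp add: sum_distrib_right of_bool_def if_distrib if_distribR cong: if_cong)
  then show ?thesis
    by (simp add: b_mult_b distrib_left sum.distrib)
qed

text \<open>The first two pairings lengthen both strands, keeping or exchanging their ends. The
  third joins the old columns to each other, which leaves a strand of exponent \<open>a + c\<close>
  between the rows, and starts a new strand \<open>b b\<close> between the new columns.\<close>

lemma step_True_True_id:
  "step (form_id a c) (True, True) =
     tensor_add (form_id (Suc a) (Suc c)) (tensor_add (form_swap (Suc a) (Suc c)) (form_cap (a + c) 2))"
proof (intro ext)
  fix x y z t
  have 1: "(\<Sum>u<n. \<Sum>v<n. form_id a c x y u v * (b u z * b v t)) = kpow (Suc a) x z * kpow (Suc c) y t"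
    unfolding form_id_def kpow.simps sum_product by (intro sum.cong refl) (simp only: mult_ac)
  have 2: "(\<Sum>u<n. \<Sum>v<n. form_id a c x y u v * (b v z * b u t)) = kpow (Suc a) x t * kpow (Suc c) y z"
    unfolding form_id_def kpow.simps sum_product by (intro sum.cong refl) (simp only: mult_ac)
  have 3: "(\<Sum>u<n. form_id a c x y u u) = kpow (a + c) x y"
    by (simp add: form_id_def kpow_mult_kpow_transpose)
  show "step (form_id a c) (True, True) x y z t =
     tensor_add (form_id (Suc a) (Suc c)) (tensor_add (form_swap (Suc a) (Suc c)) (form_cap (a + c) 2)) x y z t"
    unfolding step_True_True 1 2 3
    by (simp only: tensor_add_def form_id_def form_swap_def form_cap_def add.assoc)
qed

text \<open>As for \<open>form_id\<close>, except that the first two pairings exchange their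
  roles.\<close>

lemma step_True_True_swap:
  "step (form_swap a c) (True, True) =
     tensor_add (form_id (Suc a) (Suc c)) (tensor_add (form_swap (Suc a) (Suc c)) (form_cap (a + c) 2))"
proof (intro ext)
  fix x y z t
  have 1: "(\<Sum>u<n. \<Sum>v<n. form_swap a c x y u v * (b u z * b v t)) = kpow (Suc a) x t * kpow (Suc c) y z"
    unfolding form_swap_def kpow.simps sum_product
    by (subst sum.swap) (intro sum.cong refl, simp only: mult_ac)
  have 2: "(\<Sum>u<n. \<Sum>v<n. form_swap a c x y u v * (b v z * b u t)) = kpow (Suc a) x z * kpow (Suc c) y t"
    unfolding form_swap_def kpow.simps sum_product
    by (subst sum.swap) (intro sum.cong refl, simp only: mult_ac)
  have 3: "(\<Sum>u<n. form_swap a c x y u u) = kpow (a + c) x y"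
    by (simp add: form_swap_def kpow_mult_kpow_transpose)
  show "step (form_swap a c) (True, True) x y z t =
     tensor_add (form_id (Suc a) (Suc c)) (tensor_add (form_swap (Suc a) (Suc c)) (form_cap (a + c) 2)) x y z t"
    unfolding step_True_True 1 2 3
    by (simp only: tensor_add_def form_id_def form_swap_def form_cap_def add.assoc add.left_commute)
qed

lemma kpow_sandwich: "(\<Sum>u<n. \<Sum>v<n. kpow c u v * (b u z * b v t)) = kpow (c + 2) z t"
proof -
  have "(\<Sum>u<n. \<Sum>v<n. kpow c u v * (b u z * b v t)) = (\<Sum>u<n. b u z * kpow (Suc c) u t)"
    by (simp add: sum_distrib_left mult_ac)
  also have "\<dots> = (\<Sum>u<n. kpow 1 z u * kpow (Suc c) u t)"
    using kpow_1 b_sym by simp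
  finally show ?thesis
    by (simp only: kpow_add) simp
qed

text \<open>By symmetry of \<open>b\<close> the first two pairings agree and lengthen the column
  strand at both ends. The third closes that strand into a loop, whence the factor
  \<open>ktrace c\<close>, and starts a new one with exponent 2.\<close>

lemma step_True_True_cap:
  "step (form_cap a c) (True, True) =
     tensor_add (tensor_scale 2 (form_cap a (c + 2))) (tensor_scale (ktrace c) (form_cap a 2))"
proof (intro ext)
  fix x y z t
  have 1: "(\<Sum>u<n. \<Sum>v<n. form_cap a c x y u v * (b u z * b v t)) = kpow a x y * kpow (c + 2) z t"
    unfolding kpow_sandwich[of c z t, symmetric]
    by (simp add: form_cap_def sum_distrib_left mult_ac)
  have 2: "(\<Sum>u<n. \<Sum>v<n. form_cap a c x y u v * (b v z * b u t)) = kpow a x y * kpow (c + 2) z t"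
    unfolding kpow_sandwich[of c t z, symmetric] kpow_sym[of "c + 2" z t]
    by (simp add: form_cap_def sum_distrib_left mult_ac)
  have 3: "(\<Sum>u<n. form_cap a c x y u u) = kpow a x y * ktrace c"
    by (simp add: form_cap_def ktrace_def sum_distrib_left)
  show "step (form_cap a c) (True, True) x y z t =
     tensor_add (tensor_scale 2 (form_cap a (c + 2))) (tensor_scale (ktrace c) (form_cap a 2)) x y z t"
    unfolding step_True_True 1 2 3
    by (simp only: tensor_add_def tensor_scale_def form_cap_def) (simp add: algebra_simps)
qed

lemma run_trace_id_Nil: "run_trace (form_id a c) [] = ktrace a * ktrace c"
  by (simp add: run_trace_Nil form_id_def ktrace_def sum_product)

lemma run_trace_swap_Nil: "run_trace (form_swap a c) [] = ktrace (a + c)"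
  by (simp add: run_trace_Nil form_swap_def ktrace_def kpow_add)

lemma run_trace_cap_Nil: "run_trace (form_cap a c) [] = ktrace (a + c)"
  by (simp add: run_trace_Nil form_cap_def ktrace_def kpow_mult_kpow_transpose)

text \<open>For the word of two subsets these three counts become the cardinalities of the subsets
  and of their intersection; see \<open>cnt_pair_word\<close>.\<close>

definition cnt1 :: "(bool \<times> bool) list \<Rightarrow> nat" where
  "cnt1 w = length (filter fst w)"

definition cnt2 :: "(bool \<times> bool) list \<Rightarrow> nat" where
  "cnt2 w = length (filter snd w)"

definition cnt12 :: "(bool \<times> bool) list \<Rightarrow> nat" where
  "cnt12 w = length (filter (\<lambda>l. fst l \<and> snd l) w)"

lemma cnt_simps [simp]:
  "cnt1 [] = 0" "cnt2 [] = 0" "cnt12 [] = 0"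
  "cnt1 ((s, s') # w) = of_bool s + cnt1 w" "cnt2 ((s, s') # w) = of_bool s' + cnt2 w"
  "cnt12 ((s, s') # w) = of_bool (s \<and> s') + cnt12 w"
  by (auto simp: cnt1_def cnt2_def cnt12_def)

lemma cnt12_le: "cnt12 w \<le> cnt1 w" "cnt12 w \<le> cnt2 w"
  by (induction w) auto

lemma word_induct [case_names Nil FF TF FT TT]:
  assumes "P []"
    and "\<And>w. P w \<Longrightarrow> P ((False, False) # w)" "\<And>w. P w \<Longrightarrow> P ((True, False) # w)"
    and "\<And>w. P w \<Longrightarrow> P ((False, True) # w)" "\<And>w. P w \<Longrightarrow> P ((True, True) # w)"
  shows "P w"
proof (induction w)
  case (Cons l w)
  then show ?case using assms(2-5) by (cases l) (metis (full_types))
qed (use assms in auto)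

lemmas run_trace_step = run_trace_Cons step_True_False step_False_True step_True_True_id
  step_True_True_swap step_True_True_cap run_trace_add run_trace_scale

text \<open>Only a shared letter can close a loop before the end. All other letters lengthen the
  column strand, which the final trace joins to the row strand.\<close>

lemma run_trace_cap_disjoint:
  "cnt12 w = 0 \<Longrightarrow> run_trace (form_cap a c) w = ktrace (a + c + cnt1 w + cnt2 w)"
  by (induction w arbitrary: c rule: word_induct)
    (simp_all add: run_trace_cap_Nil run_trace_step del: step.simps(2-))

lemma run_trace_id_disjoint:
  "cnt12 w = 0 \<Longrightarrow> run_trace (form_id a c) w = ktrace (a + cnt1 w) * ktrace (c + cnt2 w)"
  by (induction w arbitrary: a c rule: word_induct)
    (simp_all add: run_trace_id_Nil run_trace_step del: step.simps(2-))

lemma run_trace_swap_disjoint: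
  "cnt12 w = 0 \<Longrightarrow> run_trace (form_swap a c) w = ktrace (a + c + cnt1 w + cnt2 w)"
  by (induction w arbitrary: a c rule: word_induct)
    (simp_all add: run_trace_swap_Nil run_trace_step del: step.simps(2-))

text \<open>The single shared letter branches into three forms and no other letter branches:
  \<open>form_id\<close> ends in two loops, \<open>form_swap\<close> and \<open>form_cap\<close> in
  one loop each, whence the coefficient 2.\<close>

lemma run_trace_id_one_common:
  assumes "cnt12 w = 1"
  shows "run_trace (form_id a c) w =
    ktrace (a + cnt1 w) * ktrace (c + cnt2 w) + 2 * ktrace (a + c + cnt1 w + cnt2 w)"
  using assms
proof (induction w arbitrary: a c rule: word_induct)
  case (TT w)
  then show ?case
    by (simp add: run_trace_step run_trace_id_disjoint run_trace_swap_disjoint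
        run_trace_cap_disjoint del: step.simps(2-))
qed (simp_all add: run_trace_step del: step.simps(2-))

end

section \<open>Counting closed loops and bounding their products\<close>

locale psd_kernel = symmetric_kernel +
  fixes \<mu> :: "nat \<Rightarrow> real"
  assumes \<mu>_nonneg: "0 \<le> \<mu> i"
    and ktrace_eq: "1 \<le> j \<Longrightarrow> ktrace j = (\<Sum>i<n. \<mu> i ^ j)"
begin

lemma ktrace_nonneg: "1 \<le> j \<Longrightarrow> 0 \<le> ktrace j"
  by (simp add: ktrace_eq \<mu>_nonneg sum_nonneg)

lemma ktrace_mult_le: "2 \<le> a \<Longrightarrow> 2 \<le> c \<Longrightarrow> ktrace a * ktrace c \<le> ktrace 2 * ktrace (a + c - 2)"
  using power_sum_mult_le[of "{..<n}" \<mu> a c] by (simp add: ktrace_eq \<mu>_nonneg)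

text \<open>
  \<open>cap_bound r e\<close> and \<open>loop_bound r e\<close> count the pairings by their number of closed loops. Once a
  cap has occurred, every later letter \<open>(True, True)\<close> has two pairings that keep the number of loops
  and one that closes a loop; before the first cap, the two other pairings close none.
\<close>

definition cap_bound :: "nat \<Rightarrow> nat \<Rightarrow> real" where
  "cap_bound r e = (\<Sum>j\<le>r. real (r choose j) * 2 ^ (r - j) * ktrace 2 ^ j * ktrace (e - 2 * j))"

definition loop_bound :: "nat \<Rightarrow> nat \<Rightarrow> real" where
  "loop_bound r e =
     (\<Sum>j<r. real (r choose Suc j) * 2 ^ (r - Suc j) * ktrace 2 ^ j * ktrace (e - 2 * j))"

lemma cap_bound_0 [simp]: "cap_bound 0 e = ktrace e"
  by (simp add: cap_bound_def)

lemma loop_bound_0 [simp]: "loop_bound 0 e = 0"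
  by (simp add: loop_bound_def)

text \<open>Pascal's rule, read as a case distinction on the first shared letter: two pairings close
  no loop, and one closes a loop of exponent 2.\<close>

lemma cap_bound_Suc:
  "cap_bound (Suc r) e = 2 * cap_bound r e +
     (\<Sum>j\<le>r. real (r choose j) * 2 ^ (r - j) * ktrace 2 ^ Suc j * ktrace (e - 2 * Suc j))"
proof -
  let ?f = "\<lambda>c j. real c * 2 ^ (Suc r - j) * ktrace 2 ^ j * ktrace (e - 2 * j)"
  have "cap_bound (Suc r) e = ?f 1 0 + (\<Sum>j\<le>r. ?f (Suc r choose Suc j) (Suc j))"
    unfolding cap_bound_def by (subst sum.atMost_Suc_shift) simp
  also have "(\<Sum>j\<le>r. ?f (Suc r choose Suc j) (Suc j)) =
      (\<Sum>j\<le>r. ?f (r choose j) (Suc j)) + (\<Sum>j\<le>r. ?f (r choose Suc j) (Suc j))"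
    unfolding sum.distrib[symmetric] by (intro sum.cong refl) (simp add: ring_distribs)
  also have "?f 1 0 + (\<dots>) = (\<Sum>j\<le>r. ?f (r choose j) (Suc j)) + (\<Sum>j\<le>Suc r. ?f (r choose j) j)"
    unfolding sum.atMost_Suc_shift[of "\<lambda>j. ?f (r choose j) j"] by simp
  \<comment> \<open>The summand at \<open>Suc r\<close> is zero because
    \<open>r choose Suc r\<close> vanishes; in the others \<open>2 ^ (Suc r - j)\<close> splits off
    the factor 2.\<close>
  also have "(\<Sum>j\<le>Suc r. ?f (r choose j) j) = 2 * cap_bound r e"
    by (simp add: cap_bound_def sum_distrib_left Suc_diff_le binomial_eq_0 mult_ac)
  finally show ?thesis by simp
qed

text \<open>Pascal's rule again: the first shared letter either postpones the first cap, in two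
  ways, or is that cap, after which \<open>cap_bound\<close> takes over. The first cap closes no
  loop, so \<open>j\<close> loops belong to \<open>Suc j\<close> caps.\<close>

lemma loop_bound_Suc: "loop_bound (Suc r) e = 2 * loop_bound r e + cap_bound r e"
proof -
  have "loop_bound (Suc r) e =
      (\<Sum>j\<le>r. real (r choose j) * 2 ^ (r - j) * ktrace 2 ^ j * ktrace (e - 2 * j)) +
      (\<Sum>j\<le>r. real (r choose Suc j) * 2 ^ (r - j) * ktrace 2 ^ j * ktrace (e - 2 * j))"
    unfolding loop_bound_def lessThan_Suc_atMost sum.distrib[symmetric]
    by (intro sum.cong refl) (simp add: ring_distribs)
  also have "(\<Sum>j\<le>r. real (r choose Suc j) * 2 ^ (r - j) * ktrace 2 ^ j * ktrace (e - 2 * j)) =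
      (\<Sum>j<r. real (r choose Suc j) * 2 ^ (r - j) * ktrace 2 ^ j * ktrace (e - 2 * j))"
    by (simp add: lessThan_Suc_atMost[symmetric])
  also have "\<dots> = 2 * loop_bound r e"
    unfolding loop_bound_def sum_distrib_left
    by (intro sum.cong) (auto simp: Suc_diff_Suc[symmetric])
  finally show ?thesis by (simp add: cap_bound_def)
qed

text \<open>Whenever a loop of exponent \<open>c\<close> closes, \<open>ktrace_mult_le\<close>
  trades it for a loop of exponent 2 and passes the excess \<open>c - 2\<close> on to the part that
  is still open. The condition on \<open>c\<close> persists, because the column strand restarts at 2
  and otherwise only grows.\<close>

lemma run_trace_cap_le:
  assumes "2 \<le> c"
  shows "run_trace (form_cap a c) w \<le> cap_bound (cnt12 w) (a + c + cnt1 w + cnt2 w)"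
  using assms
proof (induction w arbitrary: c rule: word_induct)
  case (TT w)
  define r where "r = cnt12 w"
  define e where "e = a + c + 2 + cnt1 w + cnt2 w"
  \<comment> \<open>This keeps every exponent \<open>e - c - 2 * j\<close> at least 2, so that
    subtraction is never truncated and \<open>ktrace_mult_le\<close> applies.\<close>
  have r: "2 * r \<le> cnt1 w + cnt2 w"
    using cnt12_le[of w] by (simp add: r_def)
  have "ktrace c * run_trace (form_cap a 2) w \<le> ktrace c * cap_bound r (a + 2 + cnt1 w + cnt2 w)"
    unfolding r_def using TT ktrace_nonneg[of c] by (intro mult_left_mono TT.IH) auto
  also have "a + 2 + cnt1 w + cnt2 w = e - c"
    by (simp add: e_def)
  also have "ktrace c * cap_bound r (e - c) =
      (\<Sum>j\<le>r. real (r choose j) * 2 ^ (r - j) * ktrace 2 ^ j * (ktrace c * ktrace (e - c - 2 * j)))"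
    by (simp add: cap_bound_def sum_distrib_left mult_ac)
  also have "\<dots> \<le> (\<Sum>j\<le>r. real (r choose j) * 2 ^ (r - j) * ktrace 2 ^ j * (ktrace 2 * ktrace (e - 2 * Suc j)))"
  proof (intro sum_mono mult_left_mono)
    fix j assume j: "j \<in> {..r}"
    have "ktrace c * ktrace (e - c - 2 * j) \<le> ktrace 2 * ktrace (c + (e - c - 2 * j) - 2)"
      using TT(2) r j by (intro ktrace_mult_le) (auto simp: e_def)
    also have "c + (e - c - 2 * j) - 2 = e - 2 * Suc j"
      using r j by (auto simp: e_def)
    finally show "ktrace c * ktrace (e - c - 2 * j) \<le> ktrace 2 * ktrace (e - 2 * Suc j)" .
  qed (simp add: ktrace_nonneg)
  finally have *: "ktrace c * run_trace (form_cap a 2) w \<le>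
    (\<Sum>j\<le>r. real (r choose j) * 2 ^ (r - j) * ktrace 2 ^ Suc j * ktrace (e - 2 * Suc j))"
    by (simp add: mult_ac)
  have "run_trace (form_cap a (c + 2)) w \<le> cap_bound r e"
    using TT.IH[of "c + 2"] by (simp add: r_def e_def)
  with * have "2 * run_trace (form_cap a (c + 2)) w + ktrace c * run_trace (form_cap a 2) w \<le> cap_bound (Suc r) e"
    unfolding cap_bound_Suc by linarith
  then show ?case
    by (simp add: run_trace_step r_def e_def del: step.simps(2-))
next
  case (TF w)
  then show ?case using TF.IH[of "Suc c"] by (simp add: run_trace_step del: step.simps(2-))
next
  case (FT w)
  then show ?case using FT.IH[of "Suc c"] by (simp add: run_trace_step del: step.simps(2-))
qed (simp_all add: run_trace_step run_trace_cap_Nil)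

text \<open>For \<open>r\<close> at least 1 there are \<open>2 ^ r\<close> pairings without a cap.
  The last shared letter decides whether they end as \<open>form_id\<close> with two loops or as
  \<open>form_swap\<close> with one, so each kind occurs \<open>2 ^ (r - 1)\<close> times. Pairings
  with a cap are counted by \<open>loop_bound\<close>.\<close>

definition pair_bound :: "nat \<Rightarrow> nat \<Rightarrow> real" where
  "pair_bound r e = 2 ^ (r - 1) * (ktrace 2 * ktrace (e - 2) + ktrace e) + loop_bound r e"

text \<open>Both forms are treated in one induction, since a shared letter leads from either of them
  to both. The conditions on \<open>a\<close> and \<open>c\<close> guarantee that the two loops of a
  pairing without cap have exponents at least 2.\<close>

lemma run_trace_id_swap_le:
  assumes "1 \<le> cnt12 w" "2 \<le> a + cnt12 w" "2 \<le> c + cnt12 w"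
  shows "run_trace (form_id a c) w \<le> pair_bound (cnt12 w) (a + c + cnt1 w + cnt2 w) \<and>
    run_trace (form_swap a c) w \<le> pair_bound (cnt12 w) (a + c + cnt1 w + cnt2 w)"
  using assms
proof (induction w arbitrary: a c rule: word_induct)
  case (TT w)
  define r where "r = cnt12 w"
  define e where "e = a + c + 2 + cnt1 w + cnt2 w"
  have cap: "run_trace (form_cap (a + c) 2) w \<le> cap_bound r e"
    using run_trace_cap_le[of 2 "a + c" w] by (simp add: r_def e_def)
  have "run_trace (form_id (Suc a) (Suc c)) w + run_trace (form_swap (Suc a) (Suc c)) w \<le>
    2 ^ r * (ktrace 2 * ktrace (e - 2) + ktrace e) + 2 * loop_bound r e"
  proof (cases r)
    \<comment> \<open>The letter just read was the last shared one, so \<open>form_id\<close> now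
      ends in two loops, to which \<open>ktrace_mult_le\<close> applies.\<close>
    case 0
    have "ktrace (Suc a + cnt1 w) * ktrace (Suc c + cnt2 w) \<le> ktrace 2 * ktrace (e - 2)"
      using ktrace_mult_le[of "Suc a + cnt1 w" "Suc c + cnt2 w"] TT 0 by (simp add: r_def e_def add_ac)
    moreover have "run_trace (form_swap (Suc a) (Suc c)) w = ktrace e"
      using 0 by (simp add: run_trace_swap_disjoint r_def e_def)
    moreover have "run_trace (form_id (Suc a) (Suc c)) w = ktrace (Suc a + cnt1 w) * ktrace (Suc c + cnt2 w)"
      using 0 by (subst run_trace_id_disjoint) (auto simp: r_def)
    ultimately show ?thesis using 0 by simp
  next
    case (Suc r')
    then show ?thesis
      using TT.IH[of "Suc a" "Suc c"] TT.prems by (simp add: r_def e_def pair_bound_def algebra_simps)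
  qed
  with cap have "run_trace (form_id (Suc a) (Suc c)) w + (run_trace (form_swap (Suc a) (Suc c)) w
     + run_trace (form_cap (a + c) 2) w) \<le> pair_bound (Suc r) e"
    by (simp add: pair_bound_def loop_bound_Suc)
  then show ?case
    by (simp add: run_trace_step r_def e_def del: step.simps(2-))
next
  case (TF w)
  then show ?case using TF.IH[of "Suc a" c] TF.IH[of a "Suc c"]
    by (simp add: run_trace_step del: step.simps(2-))
next
  case (FT w)
  then show ?case using FT.IH[of "Suc a" c] FT.IH[of a "Suc c"]
    by (simp add: run_trace_step del: step.simps(2-))
qed (simp_all add: run_trace_step)

lemma pair_bound_2: "pair_bound 2 e = 6 * ktrace e + 3 * ktrace 2 * ktrace (e - 2)"
  by (simp add: pair_bound_def loop_bound_def numeral_2_eq_2)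

text \<open>Both sides are combinations of the nonnegative terms \<open>m l\<close> for
  \<open>l\<close> loops, so it is enough to compare coefficients; those on the right are
  generous.\<close>

lemma pair_bound_le:
  assumes "3 \<le> r" "2 * r \<le> e"
  shows "pair_bound r e \<le> (\<Sum>l=1..r. bound_coeff r l * (ktrace 2 ^ (l - 1) * ktrace (e - 2 * (l - 1))))"
proof -
  define m where "m l = ktrace 2 ^ (l - 1) * ktrace (e - 2 * (l - 1))" for l
  \<comment> \<open>The additional \<open>2 ^ (r - 1)\<close> for one and two loops comes from the
    pairings without a cap.\<close>
  define N where "N l = real (r choose l) * 2 ^ (r - l) + (if l \<le> 2 then 2 ^ (r - 1) else 0)" for l
  have m_nonneg: "0 \<le> m l" if "l \<in> {1..r}" for l
    using that assms unfolding m_def by (intro mult_nonneg_nonneg ktrace_nonneg zero_le_power) auto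
  have "loop_bound r e = (\<Sum>l=1..r. real (r choose l) * 2 ^ (r - l) * m l)"
    unfolding loop_bound_def m_def
    by (rule sum.reindex_bij_witness[of _ "\<lambda>l. l - 1" Suc]) auto
  moreover have "2 ^ (r - 1) * (ktrace 2 * ktrace (e - 2) + ktrace e) =
      (\<Sum>l\<in>{1,2}. 2 ^ (r - 1) * m l)"
    by (simp add: m_def algebra_simps)
  moreover have "(\<Sum>l\<in>{1,2}. 2 ^ (r - 1) * m l) = (\<Sum>l=1..r. (if l \<le> 2 then 2 ^ (r - 1) else 0) * m l)"
    using assms by (intro sum.mono_neutral_cong_left) auto
  ultimately have "pair_bound r e = (\<Sum>l=1..r. N l * m l)"
    by (simp only: pair_bound_def N_def distrib_right sum.distrib add.commute)
  also have "\<dots> \<le> (\<Sum>l=1..r. bound_coeff r l * m l)"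
  proof (intro sum_mono mult_right_mono m_nonneg)
    fix l assume l: "l \<in> {1..r}"
    obtain q where q: "r = q + 2" using assms by (metis add.commute add_leD2 le_Suc_ex numeral_3_eq_3 numeral_2_eq_2 Suc_leD)
    have two_three: "(2::real) ^ i \<le> 3 ^ i" for i by (rule power_mono) auto
    consider "l = 1" | "l = 2" | "3 \<le> l" using l by force
    then show "N l \<le> bound_coeff r l"
    proof cases
      case 1
      \<comment> \<open>The left-hand side is \<open>N 1\<close>. From one \<open>r\<close> to the
        next it grows by a factor of at most 3.\<close>
      have *: "(real r + 1) * 2 ^ (r - 1) \<le> 3 ^ r"
        using assms(1)
      proof (induction r rule: dec_induct)
        case (step s)
        then obtain t where t: "s = Suc t" by (cases s) auto
        have "(real (Suc s) + 1) * 2 ^ (Suc s - 1) \<le> 3 * ((real s + 1) * 2 ^ (s - 1))"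
          by (simp add: t algebra_simps)
        then show ?case using step by simp
      qed simp
      then show ?thesis using 1 by (simp add: N_def bound_coeff_def algebra_simps)
    next
      case 2
      have c: "real (r choose 2) \<le> 2 ^ r - 1"
      proof -
        \<comment> \<open>Two entries of a row of Pascal's triangle are compared with the sum of the
          row.\<close>
        have "(r choose 0) + (r choose 2) \<le> (\<Sum>i\<le>r. r choose i)"
          using assms sum_mono2[of "{..r}" "{0, 2}" "(choose) r"] by simp
        then have "real (1 + (r choose 2)) \<le> real (2 ^ r)"
          by (simp only: choose_row_sum binomial_n_0 of_nat_le_iff)
        then show ?thesis by simp
      qed
      have "N l = 2 ^ q * (real (r choose 2) + 2)"
        using 2 q by (simp add: N_def algebra_simps)
      also have "\<dots> \<le> 3 ^ q * (2 ^ (r + 1) - 1)"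
      proof (rule mult_mono)
        have "(2::real) ^ 1 \<le> 2 ^ r" using assms by (intro power_increasing) auto
        then show "real (r choose 2) + 2 \<le> 2 ^ (r + 1) - 1" using c by simp
      qed (auto simp: two_three)
      finally show ?thesis using 2 q by (simp add: bound_coeff_def)
    next
      case 3
      have "real (r choose l) \<le> 2 ^ r"
        using binomial_le_pow2[of r l] by (metis of_nat_le_iff of_nat_numeral of_nat_power)
      also have "\<dots> \<le> real l ^ r" using 3 by (intro power_mono) auto
      finally have "real (r choose l) * 2 ^ (r - l) \<le> real l ^ r * 3 ^ (r - l)"
        by (intro mult_mono two_three) auto
      then show ?thesis using 3 by (simp add: N_def bound_coeff_def mult.commute)
    qed
  qed
  finally show ?thesis by (simp add: m_def)
qed

end

section \<open>Gaussian expectations\<close>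

definition gauss_moment :: "nat \<Rightarrow> real" where
  "gauss_moment m = (\<integral>x. std_normal_density x * x ^ m \<partial>lborel)"

text \<open>Moments up to order four suffice, because a column shared by two subsets enters the
  product through four factors.\<close>

lemma gauss_moment_simps:
  "gauss_moment 0 = 1" "gauss_moment (Suc 0) = 0" "gauss_moment (Suc (Suc 0)) = 1"
  "gauss_moment (Suc (Suc (Suc 0))) = 0" "gauss_moment (Suc (Suc (Suc (Suc 0)))) = 3"
proof -
  have "gauss_moment 0 = 1" "gauss_moment 1 = 0" "gauss_moment 2 = 1"
    "gauss_moment 3 = 0" "gauss_moment 4 = 3"
    using integral_std_normal_moment_even[of 0] integral_std_normal_moment_odd[of 0]
      integral_std_normal_moment_even[of 1] integral_std_normal_moment_odd[of 1]
      integral_std_normal_moment_even[of 2]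
    by (simp_all add: gauss_moment_def fact_numeral)
  then show "gauss_moment 0 = 1" "gauss_moment (Suc 0) = 0" "gauss_moment (Suc (Suc 0)) = 1"
    "gauss_moment (Suc (Suc (Suc 0))) = 0" "gauss_moment (Suc (Suc (Suc (Suc 0)))) = 3"
    by (simp_all add: numeral_eq_Suc)
qed

lemma (in prob_space) has_bochner_integral_gauss_power:
  assumes "distributed M lborel X std_normal_density"
  shows "has_bochner_integral M (\<lambda>\<omega>. X \<omega> ^ m) (gauss_moment m)"
proof -
  have "integrable M (\<lambda>\<omega>. X \<omega> ^ m)"
    using distributed_integrable[OF assms, of "\<lambda>x. x ^ m"] integrable_std_normal_moment[of m] by simp
  moreover have "expectation (\<lambda>\<omega>. X \<omega> ^ m) = gauss_moment m"
    using distributed_integral[OF assms, of "\<lambda>x. x ^ m"] by (simp add: gauss_moment_def)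
  ultimately show ?thesis by (simp add: has_bochner_integral_iff)
qed

text \<open>For indices below \<open>n\<close> this is the mean of the product of the coordinates
  listed in \<open>L\<close> of a standard Gaussian vector: independence factors it by
  coordinates.\<close>

definition gauss_mixed_moment :: "nat \<Rightarrow> nat list \<Rightarrow> real" where
  "gauss_mixed_moment n L = (\<Prod>a<n. gauss_moment (count_list L a))"

lemma prod_list_eq_prod_power:
  fixes f :: "nat \<Rightarrow> 'b :: comm_monoid_mult"
  assumes "set L \<subseteq> {..<n}"
  shows "(\<Prod>u\<leftarrow>L. f u) = (\<Prod>a<n. f a ^ count_list L a)"
  using assms
proof (induction L)
  case (Cons u L)
  have "(\<Prod>a<n. f a ^ count_list (u # L) a) = (\<Prod>a<n. (if a = u then f u else 1) * f a ^ count_list L a)"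
    by (intro prod.cong) auto
  also have "\<dots> = f u * (\<Prod>a<n. f a ^ count_list L a)"
    using Cons.prems by (simp add: prod.distrib)
  finally show ?case using Cons by simp
qed simp

lemma gauss_mixed_moment_Nil [simp]: "gauss_mixed_moment n [] = 1"
  by (simp add: gauss_mixed_moment_def gauss_moment_simps)

lemma gauss_mixed_moment_eq:
  assumes "set L \<subseteq> {..<n}"
  shows "gauss_mixed_moment n L = (\<Prod>a\<in>set L. gauss_moment (count_list L a))"
  unfolding gauss_mixed_moment_def
  using assms by (intro prod.mono_neutral_right) (auto simp: gauss_moment_simps)

lemma gauss_mixed_moment_2:
  assumes "u < n" "v < n"
  shows "gauss_mixed_moment n [u, v] = of_bool (u = v)"
  using assms by (subst gauss_mixed_moment_eq) (auto simp: gauss_moment_simps)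

text \<open>Wick's formula, by inspection of all coincidence patterns of the four indices. If all
  are equal, the three pairings add up to the fourth moment 3.\<close>

lemma gauss_mixed_moment_4:
  assumes "u < n" "v < n" "w < n" "z < n"
  shows "gauss_mixed_moment n [u, v, w, z] =
    of_bool (u = v \<and> w = z) + of_bool (u = w \<and> v = z) + of_bool (u = z \<and> v = w)"
proof -
  have "gauss_mixed_moment n [u, v, w, z] = (\<Prod>a\<in>set [u, v, w, z]. gauss_moment (count_list [u, v, w, z] a))"
    using assms by (intro gauss_mixed_moment_eq) simp
  then show ?thesis
    by (cases "u = v"; cases "u = w"; cases "u = z"; cases "v = w"; cases "v = z"; cases "w = z")
      (simp_all add: gauss_moment_simps insert_absorb)
qed

section \<open>Ordered products over subsets of columns and their mean tensors\<close>

context symmetric_kernel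
begin

text \<open>With \<open>g\<^sub>i\<close> the column \<open>i\<close> of \<open>W\<close>, this is
  the entry \<open>(x, z)\<close> of the product of the matrices
  \<open>g\<^sub>i g\<^sub>i\<^sup>T b\<close> over the elements \<open>i\<close> of
  \<open>S\<close> below \<open>c\<close>, in increasing order.\<close>

fun sub_prod :: "(nat \<Rightarrow> nat \<Rightarrow> real) \<Rightarrow> nat set \<Rightarrow> nat \<Rightarrow> nat \<Rightarrow> nat \<Rightarrow> real" where
  "sub_prod W S 0 x z = of_bool (x = z \<and> x < n)"
| "sub_prod W S (Suc c) x z =
     (if c \<in> S then \<Sum>u<n. \<Sum>d<n. sub_prod W S c x u * (W u c * W d c * b d z) else sub_prod W S c x z)"

lemma sub_prod_empty: "sub_prod W {} c x z = of_bool (x = z \<and> x < n)"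
  by (induction c) auto

definition pair_word :: "nat set \<Rightarrow> nat set \<Rightarrow> nat \<Rightarrow> (bool \<times> bool) list" where
  "pair_word S S' c = map (\<lambda>i. (i \<in> S, i \<in> S')) [0..<c]"

definition mean_tensor :: "nat set \<Rightarrow> nat set \<Rightarrow> nat \<Rightarrow> four_tensor" where
  "mean_tensor S S' c = foldl step (form_id 0 0) (pair_word S S' c)"

lemma mean_tensor_0: "mean_tensor S S' 0 x y z t = of_bool (x = z \<and> x < n) * of_bool (y = t \<and> y < n)"
  by (simp add: mean_tensor_def pair_word_def form_id_def)

lemma mean_tensor_Suc: "mean_tensor S S' (Suc c) = step (mean_tensor S S' c) (c \<in> S, c \<in> S')"
  by (simp add: mean_tensor_def pair_word_def)

end

locale gaussian_sketch = psd_kernel n b \<mu> + prob_space M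
  for n b \<mu> and M :: "'a measure" +
  fixes k :: nat and \<Omega> :: "'a \<Rightarrow> real mat"
  assumes gauss: "std_gaussian_mat M n k \<Omega>"
begin

definition entry :: "'a \<Rightarrow> nat \<Rightarrow> nat \<Rightarrow> real" where
  "entry \<omega> a j = \<Omega> \<omega> $$ (a, j)"

text \<open>Collecting equal factors into powers turns the monomial into a product of functions of
  distinct entries of \<open>\<Omega>\<close>, and independence factors its mean.\<close>

lemma has_bochner_integral_monomial:
  assumes "\<And>j. set (L j) \<subseteq> {..<n}"
  shows "has_bochner_integral M (\<lambda>\<omega>. \<Prod>j=c..<k. \<Prod>u\<leftarrow>L j. entry \<omega> u j)
    (\<Prod>j=c..<k. gauss_mixed_moment n (L j))"
proof -
  define I where "I = {..<n} \<times> {c..<k}"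
  define X where "X = (\<lambda>(a, j) \<omega>. \<Omega> \<omega> $$ (a, j) ^ count_list (L j) a)"
  have "indep_vars (\<lambda>_. borel) (\<lambda>(i, j) \<omega>. \<Omega> \<omega> $$ (i, j)) I"
    using gauss unfolding std_gaussian_mat_def I_def
    by (elim conjE) (erule indep_vars_subset, auto)
  from indep_vars_compose2[OF this, of "\<lambda>(a, j) x. x ^ count_list (L j) a" "\<lambda>_. borel"]
  have ind: "indep_vars (\<lambda>_. borel) X I"
    by (simp add: X_def case_prod_unfold)
  have int: "has_bochner_integral M (X i) (gauss_moment (count_list (L (snd i)) (fst i)))" if "i \<in> I" for i
    using that gauss has_bochner_integral_gauss_power
    by (auto simp: X_def I_def std_gaussian_mat_def)
  have "has_bochner_integral M (\<lambda>\<omega>. \<Prod>i\<in>I. X i \<omega>) (\<Prod>i\<in>I. gauss_moment (count_list (L (snd i)) (fst i)))"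
    using indep_vars_integrable[OF _ ind] indep_vars_lebesgue_integral[OF _ ind] int
    by (simp add: has_bochner_integral_iff I_def)
  moreover have "(\<Prod>i\<in>I. gauss_moment (count_list (L (snd i)) (fst i))) = (\<Prod>j=c..<k. gauss_mixed_moment n (L j))"
    unfolding I_def gauss_mixed_moment_def
    by (subst prod.swap) (simp add: prod.cartesian_product case_prod_unfold)
  moreover have "(\<Prod>i\<in>I. X i \<omega>) = (\<Prod>j=c..<k. \<Prod>u\<leftarrow>L j. entry \<omega> u j)" for \<omega>
  proof -
    have "(\<Prod>j=c..<k. \<Prod>u\<leftarrow>L j. entry \<omega> u j) = (\<Prod>j=c..<k. \<Prod>a<n. entry \<omega> a j ^ count_list (L j) a)"
      by (intro prod.cong refl prod_list_eq_prod_power assms)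
    also have "\<dots> = (\<Prod>i\<in>I. X i \<omega>)"
      unfolding I_def
      by (subst prod.swap) (simp add: prod.cartesian_product case_prod_unfold X_def entry_def)
    finally show ?thesis by simp
  qed
  ultimately show ?thesis by simp
qed

text \<open>
  The monomial in the columns \<open>c..<k\<close> makes the induction go through: passing from \<open>c\<close> to \<open>Suc c\<close>
  expands the factors of column \<open>c\<close> into it.
\<close>

lemma has_bochner_integral_sub_prod_monomial:
  assumes "c \<le> k" "\<And>j. set (L j) \<subseteq> {..<n}"
  shows "has_bochner_integral M
    (\<lambda>\<omega>. sub_prod (entry \<omega>) S c x z * sub_prod (entry \<omega>) S' c y t * (\<Prod>j=c..<k. \<Prod>u\<leftarrow>L j. entry \<omega> u j))
    (mean_tensor S S' c x y z t * (\<Prod>j=c..<k. gauss_mixed_moment n (L j)))"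
  using assms
proof (induction c arbitrary: x y z t L)
  case 0
  have "has_bochner_integral M (\<lambda>\<omega>. of_bool (x = z \<and> x < n) * of_bool (y = t \<and> y < n) *
      (\<Prod>j=0..<k. \<Prod>u\<leftarrow>L j. entry \<omega> u j))
    (of_bool (x = z \<and> x < n) * of_bool (y = t \<and> y < n) * (\<Prod>j=0..<k. gauss_mixed_moment n (L j)))"
    using 0 by (intro has_bochner_integral_mult_right has_bochner_integral_monomial) auto
  then show ?case by (simp add: mean_tensor_0)
next
  case (Suc c)
  define R where "R \<omega> = (\<Prod>j=Suc c..<k. \<Prod>u\<leftarrow>L j. entry \<omega> u j)" for \<omega>
  define r where "r = (\<Prod>j=Suc c..<k. gauss_mixed_moment n (L j))"
  define P where "P \<omega> = sub_prod (entry \<omega>) S c" for \<omega>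
  define P' where "P' \<omega> = sub_prod (entry \<omega>) S' c" for \<omega>
  define m where "m = mean_tensor S S' c"
  have split: "{c..<k} = insert c {Suc c..<k}" using Suc.prems by auto
  \<comment> \<open>The list of column \<open>c\<close> is replaced by \<open>l\<close>, which is to
    hold exactly the factors released when column \<open>c\<close> is expanded. The given
    \<open>L c\<close> does not occur in the monomial over the later columns.\<close>
  have IH: "has_bochner_integral M
      (\<lambda>\<omega>. P \<omega> x z * P' \<omega> y t * ((\<Prod>u\<leftarrow>l. entry \<omega> u c) * R \<omega>))
      (m x y z t * (gauss_mixed_moment n l * r))" if "set l \<subseteq> {..<n}" for x y z t l
  proof -
    have eq: "(\<Prod>j=c..<k. \<Prod>u\<leftarrow>(L(c := l)) j. entry \<omega> u j) = (\<Prod>u\<leftarrow>l. entry \<omega> u c) * R \<omega>" for \<omega>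
      unfolding split R_def by (subst prod.insert) (auto intro!: prod.cong)
    have eq': "(\<Prod>j=c..<k. gauss_mixed_moment n ((L(c := l)) j)) = gauss_mixed_moment n l * r"
      unfolding split r_def by (subst prod.insert) (auto intro!: prod.cong)
    have "set ((L(c := l)) j) \<subseteq> {..<n}" for j
      using Suc.prems that by simp
    then show ?thesis
      using Suc.IH[of "L(c := l)" x z y t] Suc.prems(1)
      unfolding eq eq' P_def P'_def m_def by simp
  qed
  have goal: ?case if
    "has_bochner_integral M (\<lambda>\<omega>. sub_prod (entry \<omega>) S (Suc c) x z * sub_prod (entry \<omega>) S' (Suc c) y t * R \<omega>) v"
    "v = step m (c \<in> S, c \<in> S') x y z t * r" for v
    using that by (simp only: R_def r_def m_def mean_tensor_Suc)
  consider "c \<notin> S" "c \<notin> S'" | "c \<in> S" "c \<notin> S'" | "c \<notin> S" "c \<in> S'" | "c \<in> S" "c \<in> S'" by blast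
  then show ?case
  proof cases
    case 1
    show ?thesis
      by (rule goal) (use IH[of "[]" x z y t] 1 in \<open>simp_all add: P_def P'_def\<close>)
  next
    case 2
    show ?thesis
    proof (rule goal)
      have "has_bochner_integral M
        (\<lambda>\<omega>. \<Sum>u<n. \<Sum>d<n. b d z * (P \<omega> x u * P' \<omega> y t * ((\<Prod>u\<leftarrow>[u, d]. entry \<omega> u c) * R \<omega>)))
        (\<Sum>u<n. \<Sum>d<n. b d z * (m x y u t * (gauss_mixed_moment n [u, d] * r)))"
        by (intro has_bochner_integral_sum has_bochner_integral_mult_right IH) auto
      then show "has_bochner_integral M
        (\<lambda>\<omega>. sub_prod (entry \<omega>) S (Suc c) x z * sub_prod (entry \<omega>) S' (Suc c) y t * R \<omega>)
        (\<Sum>u<n. \<Sum>d<n. b d z * (m x y u t * (gauss_mixed_moment n [u, d] * r)))"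
        using 2 by (simp add: P_def P'_def sum_distrib_left sum_distrib_right mult_ac)
      \<comment> \<open>The second moment is zero unless \<open>d = u\<close>, so the sum over
        \<open>d\<close> collapses.\<close>
      have "(\<Sum>u<n. \<Sum>d<n. b d z * (m x y u t * (gauss_mixed_moment n [u, d] * r))) =
        (\<Sum>u<n. \<Sum>d<n. if d = u then b d z * (m x y u t * r) else 0)"
        by (intro sum.cong refl) (auto simp: gauss_mixed_moment_2)
      then show "(\<Sum>u<n. \<Sum>d<n. b d z * (m x y u t * (gauss_mixed_moment n [u, d] * r))) =
        step m (c \<in> S, c \<in> S') x y z t * r"
        using 2 by (simp add: sum_distrib_left sum_distrib_right mult_ac)
    qed
  next
    case 3
    show ?thesis
    proof (rule goal)
      have "has_bochner_integral M
        (\<lambda>\<omega>. \<Sum>u<n. \<Sum>d<n. b d t * (P \<omega> x z * P' \<omega> y u * ((\<Prod>u\<leftarrow>[u, d]. entry \<omega> u c) * R \<omega>)))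
        (\<Sum>u<n. \<Sum>d<n. b d t * (m x y z u * (gauss_mixed_moment n [u, d] * r)))"
        by (intro has_bochner_integral_sum has_bochner_integral_mult_right IH) auto
      then show "has_bochner_integral M
        (\<lambda>\<omega>. sub_prod (entry \<omega>) S (Suc c) x z * sub_prod (entry \<omega>) S' (Suc c) y t * R \<omega>)
        (\<Sum>u<n. \<Sum>d<n. b d t * (m x y z u * (gauss_mixed_moment n [u, d] * r)))"
        using 3 by (simp add: P_def P'_def sum_distrib_left sum_distrib_right mult_ac)
      have "(\<Sum>u<n. \<Sum>d<n. b d t * (m x y z u * (gauss_mixed_moment n [u, d] * r))) =
        (\<Sum>u<n. \<Sum>d<n. if d = u then b d t * (m x y z u * r) else 0)"
        by (intro sum.cong refl) (auto simp: gauss_mixed_moment_2)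
      then show "(\<Sum>u<n. \<Sum>d<n. b d t * (m x y z u * (gauss_mixed_moment n [u, d] * r))) =
        step m (c \<in> S, c \<in> S') x y z t * r"
        using 3 by (simp add: sum_distrib_left sum_distrib_right mult_ac)
    qed
  next
    case 4
    let ?v = "\<Sum>u<n. \<Sum>v<n. \<Sum>d<n. \<Sum>f<n. b d z * b f t *
      (m x y u v * (gauss_mixed_moment n [u, d, v, f] * r))"
    show ?thesis
    proof (rule goal)
      have "has_bochner_integral M
        (\<lambda>\<omega>. \<Sum>u<n. \<Sum>v<n. \<Sum>d<n. \<Sum>f<n. b d z * b f t *
          (P \<omega> x u * P' \<omega> y v * ((\<Prod>u\<leftarrow>[u, d, v, f]. entry \<omega> u c) * R \<omega>))) ?v"
        by (intro has_bochner_integral_sum has_bochner_integral_mult_right IH) auto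
      moreover have "sub_prod (entry \<omega>) S (Suc c) x z * sub_prod (entry \<omega>) S' (Suc c) y t * R \<omega> =
        (\<Sum>u<n. \<Sum>v<n. \<Sum>d<n. \<Sum>f<n. b d z * b f t *
          (P \<omega> x u * P' \<omega> y v * ((\<Prod>u\<leftarrow>[u, d, v, f]. entry \<omega> u c) * R \<omega>)))" for \<omega>
      proof -
        define F where "F u = (\<Sum>d<n. P \<omega> x u * (entry \<omega> u c * entry \<omega> d c * b d z))" for u
        define G where "G v = (\<Sum>f<n. P' \<omega> y v * (entry \<omega> v c * entry \<omega> f c * b f t))" for v
        have "sub_prod (entry \<omega>) S (Suc c) x z * sub_prod (entry \<omega>) S' (Suc c) y t * R \<omega> =
            (\<Sum>u<n. F u) * (\<Sum>v<n. G v) * R \<omega>"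
          using 4 by (simp add: P_def P'_def F_def G_def)
        also have "\<dots> = (\<Sum>u<n. \<Sum>v<n. F u * G v * R \<omega>)"
          by (subst sum_product) (simp only: sum_distrib_right)
        finally have "sub_prod (entry \<omega>) S (Suc c) x z * sub_prod (entry \<omega>) S' (Suc c) y t * R \<omega> =
            (\<Sum>u<n. \<Sum>v<n. F u * G v * R \<omega>)" .
        moreover have "F u * G v * R \<omega> = (\<Sum>d<n. \<Sum>f<n. b d z * b f t *
            (P \<omega> x u * P' \<omega> y v * ((\<Prod>u\<leftarrow>[u, d, v, f]. entry \<omega> u c) * R \<omega>)))" for u v
          unfolding F_def G_def by (subst sum_product) (simp add: sum_distrib_left sum_distrib_right mult_ac)
        ultimately show ?thesis by (simp only:)
      qed
      ultimately show "has_bochner_integral M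
        (\<lambda>\<omega>. sub_prod (entry \<omega>) S (Suc c) x z * sub_prod (entry \<omega>) S' (Suc c) y t * R \<omega>) ?v"
        by simp
      have "(\<Sum>d<n. \<Sum>f<n. b d z * b f t * (m x y u v * (gauss_mixed_moment n [u, d, v, f] * r))) =
         m x y u v * (b u z * b v t + b v z * b u t + of_bool (u = v) * (\<Sum>w<n. b w z * b w t)) * r"
        if "u < n" "v < n" for u v
      proof -
        have "(\<Sum>d<n. \<Sum>f<n. b d z * b f t * (m x y u v * (gauss_mixed_moment n [u, d, v, f] * r))) =
          m x y u v * r * (\<Sum>d<n. \<Sum>f<n. b d z * b f t * gauss_mixed_moment n [u, d, v, f])"
          by (simp add: sum_distrib_left mult_ac)
        \<comment> \<open>The pairing \<open>d = u\<close>, \<open>f = v\<close> keeps the two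
          products apart, \<open>f = u\<close>, \<open>d = v\<close> crosses them, and
          \<open>u = v\<close>, \<open>f = d\<close> joins old columns with old and new with
          new.\<close>
        also have "(\<Sum>d<n. \<Sum>f<n. b d z * b f t * gauss_mixed_moment n [u, d, v, f]) =
          (\<Sum>d<n. \<Sum>f<n. (if d = u then if f = v then b d z * b f t else 0 else 0) +
             (if f = u then if d = v then b d z * b f t else 0 else 0) +
             (if f = d then of_bool (u = v) * (b d z * b f t) else 0))"
          using that by (intro sum.cong refl) (auto simp: gauss_mixed_moment_4)
        also have "\<dots> = b u z * b v t + b v z * b u t + of_bool (u = v) * (\<Sum>w<n. b w z * b w t)"
          using that by (simp add: sum.distrib sum_distrib_left if_distrib[of "sum _"] sum.If_cases del: if_split cong: if_cong)
        finally show ?thesis by (simp add: mult_ac)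
      qed
      then show "?v = step m (c \<in> S, c \<in> S') x y z t * r"
        using 4 by (simp add: sum_distrib_right)
    qed
  qed
qed

lemma has_bochner_integral_sub_prod:
  "has_bochner_integral M (\<lambda>\<omega>. sub_prod (entry \<omega>) S k x z * sub_prod (entry \<omega>) S' k y t)
    (mean_tensor S S' k x y z t)"
  using has_bochner_integral_sub_prod_monomial[of k "\<lambda>_. []"] by simp

text \<open>For nonempty \<open>S\<close> inside \<open>{..<k}\<close> this trace is the cyclic
  product of the entries of the sketched Gram matrix along the elements of \<open>S\<close> in
  increasing order, hence one summand of the unnormalized estimator.\<close>

definition loop :: "nat set \<Rightarrow> 'a \<Rightarrow> real" where
  "loop S \<omega> = (\<Sum>x<n. sub_prod (entry \<omega>) S k x x)"

lemma has_bochner_integral_loop_mult: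
  "has_bochner_integral M (\<lambda>\<omega>. loop S \<omega> * loop S' \<omega>) (run_trace (form_id 0 0) (pair_word S S' k))"
proof -
  have "has_bochner_integral M
      (\<lambda>\<omega>. \<Sum>x<n. \<Sum>y<n. sub_prod (entry \<omega>) S k x x * sub_prod (entry \<omega>) S' k y y)
      (\<Sum>x<n. \<Sum>y<n. mean_tensor S S' k x y x y)"
    by (intro has_bochner_integral_sum has_bochner_integral_sub_prod)
  then show ?thesis
    by (simp add: loop_def sum_product run_trace_def mean_tensor_def)
qed

lemma foldl_step_id_empty:
  "foldl step (form_id a c) (map (\<lambda>i. (i \<in> S, i \<in> {})) xs) = form_id (a + length (filter (\<lambda>i. i \<in> S) xs)) c"
proof (induction xs arbitrary: a)
  case (Cons i xs)
  then show ?case by (cases "i \<in> S") (simp_all add: step_True_False del: step.simps(2-))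
qed simp

lemma length_filter_mem_upt: "S \<subseteq> {..<k} \<Longrightarrow> length (filter (\<lambda>i. i \<in> S) [0..<k]) = card S"
proof -
  assume "S \<subseteq> {..<k}"
  then have "set (filter (\<lambda>i. i \<in> S) [0..<k]) = S" by auto
  then show ?thesis using distinct_card[of "filter (\<lambda>i. i \<in> S) [0..<k]"] by simp
qed

text \<open>A single mean is a pair mean whose second subset is empty: the second product is then
  the identity, and only the first strand of \<open>form_id\<close> grows.\<close>

lemma has_bochner_integral_loop:
  assumes "S \<subseteq> {..<k}"
  shows "has_bochner_integral M (loop S) (ktrace (card S))"
proof -
  have "mean_tensor S {} k = form_id (card S) 0"
    using assms foldl_step_id_empty[of 0 0 S "[0..<k]"]
    by (simp add: mean_tensor_def pair_word_def length_filter_mem_upt)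
  then have "has_bochner_integral M (\<lambda>\<omega>. sub_prod (entry \<omega>) S k x x) (kpow (card S) x x)" if "x < n" for x
    using has_bochner_integral_sub_prod[of S x x "{}" x x] that by (simp add: form_id_def sub_prod_empty)
  then show ?thesis
    unfolding loop_def ktrace_def by (intro has_bochner_integral_sum) auto
qed

lemma cnt_pair_word:
  assumes "S \<subseteq> {..<k}" "S' \<subseteq> {..<k}"
  shows "cnt1 (pair_word S S' k) = card S" "cnt2 (pair_word S S' k) = card S'"
    "cnt12 (pair_word S S' k) = card (S \<inter> S')"
  using length_filter_mem_upt[of S] length_filter_mem_upt[of S'] length_filter_mem_upt[of "S \<inter> S'"] assms
  by (auto simp: cnt1_def cnt2_def cnt12_def pair_word_def filter_map comp_def)

end

section \<open>Schatten norms and traces of the Gram matrix\<close>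

lemma mat_trace_mult_comm:
  assumes "X \<in> carrier_mat n m" "Y \<in> carrier_mat m n"
  shows "mat_trace (X * Y) = mat_trace (Y * X)"
proof -
  have "mat_trace (X * Y) = (\<Sum>i<n. \<Sum>j<m. X $$ (i, j) * Y $$ (j, i))"
    using assms by (simp add: mat_trace_def scalar_prod_def atLeast0LessThan)
  also have "\<dots> = (\<Sum>j<m. \<Sum>i<n. Y $$ (j, i) * X $$ (i, j))"
    by (subst sum.swap) (simp add: mult.commute)
  finally show ?thesis
    using assms by (simp add: mat_trace_def scalar_prod_def atLeast0LessThan)
qed

text \<open>A nonzero product \<open>X $$ (i, l) * Y $$ (l, j)\<close> forces
  \<open>i \<le> l\<close> and \<open>l \<le> j\<close>. This is impossible below the diagonal and
  leaves \<open>l = i\<close> on it.\<close>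

lemma upper_triangular_mult_diag:
  fixes X Y :: "real mat"
  assumes "X \<in> carrier_mat n n" "Y \<in> carrier_mat n n" "upper_triangular X" "upper_triangular Y"
  shows "upper_triangular (X * Y)" "i < n \<Longrightarrow> (X * Y) $$ (i, i) = X $$ (i, i) * Y $$ (i, i)"
proof -
  show "upper_triangular (X * Y)"
  proof (rule upper_triangularI)
    fix i j assume ij: "j < i" "i < dim_row (X * Y)"
    have "X $$ (i, l) * Y $$ (l, j) = 0" if "l < n" for l
      using that ij assms upper_triangularD[OF assms(3), of l i] upper_triangularD[OF assms(4), of j l]
      by (cases "l < i") auto
    then show "(X * Y) $$ (i, j) = 0"
      using ij assms by (auto simp: scalar_prod_def intro!: sum.neutral)
  qed
  assume i: "i < n"
  have "X $$ (i, l) * Y $$ (l, i) = (if l = i then X $$ (i, i) * Y $$ (i, i) else 0)" if "l < n" for l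
    using that i assms upper_triangularD[OF assms(3), of l i] upper_triangularD[OF assms(4), of i l]
    by (cases l i rule: linorder_cases) auto
  then have "(\<Sum>l<n. X $$ (i, l) * Y $$ (l, i)) = (\<Sum>l<n. if l = i then X $$ (i, i) * Y $$ (i, i) else 0)"
    by (intro sum.cong refl) (simp only: lessThan_iff)
  then show "(X * Y) $$ (i, i) = X $$ (i, i) * Y $$ (i, i)"
    using i assms(1,2) by (simp add: scalar_prod_def atLeast0LessThan)
qed

lemma upper_triangular_pow_diag:
  fixes X :: "real mat"
  assumes "X \<in> carrier_mat n n" "upper_triangular X"
  shows "upper_triangular (X ^\<^sub>m j) \<and> (\<forall>i<n. (X ^\<^sub>m j) $$ (i, i) = (X $$ (i, i)) ^ j)"
proof (induction j)
  case 0
  then show ?case using assms by auto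
next
  case (Suc j)
  then show ?case
    using assms upper_triangular_mult_diag[of "X ^\<^sub>m j" n X] by (auto simp: mult.commute)
qed

text \<open>Schur decomposition makes \<open>G\<close> similar to an upper triangular matrix with
  diagonal \<open>es\<close>. Traces of powers are invariant under similarity, and powers of a
  triangular matrix have the powers on their diagonal.\<close>

lemma mat_trace_pow_char_poly_splits:
  fixes G :: "real mat"
  assumes G: "G \<in> carrier_mat n n" and es: "char_poly G = (\<Prod>e\<leftarrow>es. [:- e, 1:])"
  shows "length es = n" "mat_trace (G ^\<^sub>m j) = (\<Sum>e\<leftarrow>es. e ^ j)"
proof -
  obtain T P Q where T: "schur_decomposition G es = (T, P, Q)" by (cases "schur_decomposition G es")
  note sd = schur_decomposition[OF G es T]
  have wit: "similar_mat_wit G T P Q" and up: "upper_triangular T" and diag: "diag_mat T = es"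
    using sd by auto
  note car = similar_mat_witD2[OF G wit]
  show len: "length es = n"
    using car diag by (auto simp: diag_mat_def)
  have "G ^\<^sub>m j = P * T ^\<^sub>m j * Q"
    by (rule similar_mat_wit_pow_id[OF wit])
  also have "mat_trace (P * T ^\<^sub>m j * Q) = mat_trace (P * (T ^\<^sub>m j * Q))"
    using car by (subst assoc_mult_mat[of _ n n _ n _ n]) auto
  also have "\<dots> = mat_trace (T ^\<^sub>m j * Q * P)"
    using car by (intro mat_trace_mult_comm[of _ n n]) auto
  also have "T ^\<^sub>m j * Q * P = T ^\<^sub>m j"
    using car by (subst assoc_mult_mat[of _ n n _ n _ n]) auto
  also have "mat_trace (T ^\<^sub>m j) = (\<Sum>i<n. (T $$ (i, i)) ^ j)"
    using car upper_triangular_pow_diag[of T n j] up by (simp add: mat_trace_def)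
  also have "\<dots> = (\<Sum>i<n. es ! i ^ j)"
    using car by (simp add: diag[symmetric] diag_mat_def)
  also have "\<dots> = (\<Sum>e\<leftarrow>es. e ^ j)"
    by (simp add: sum_list_sum_nth len atLeast0LessThan)
  finally show "mat_trace (G ^\<^sub>m j) = (\<Sum>e\<leftarrow>es. e ^ j)" .
qed

text \<open>Pairing the eigenvector equation with the conjugate of \<open>v\<close> gives
  \<open>c * N = K\<close>, where \<open>N\<close> and \<open>K\<close> are the squared lengths of
  \<open>v\<close> and \<open>A v\<close>. Both are real and nonnegative, and \<open>N\<close> is
  nonzero.\<close>

lemma gram_eigenvalue_real_nonneg:
  fixes A :: "real mat" and c :: complex
  assumes A: "A \<in> carrier_mat m n"
    and ev: "eigenvalue (map_mat complex_of_real (transpose_mat A * A)) c"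
  shows "\<exists>r\<ge>0. c = complex_of_real r"
proof -
  let ?G = "map_mat complex_of_real (transpose_mat A * A)"
  obtain v where v: "v \<in> carrier_vec n" "v \<noteq> 0\<^sub>v n" "?G *\<^sub>v v = c \<cdot>\<^sub>v v"
    using ev A by (auto simp: eigenvalue_def eigenvector_def)
  define f where "f = vec_index v"
  define a where "a i x = A $$ (i, x)" for i x
  have eq: "(\<Sum>y<n. \<Sum>i<m. of_real (a i x * a i y) * f y) = c * f x" if "x < n" for x
  proof -
    have "vec_index (?G *\<^sub>v v) x = (\<Sum>y<n. (\<Sum>i<m. of_real (a i x * a i y)) * f y)"
      using that A v(1) by (simp add: scalar_prod_def a_def f_def atLeast0LessThan)
    then show ?thesis
      unfolding v(3) using that v(1) by (simp add: f_def sum_distrib_right)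
  qed
  define N where "N = (\<Sum>x<n. (cmod (f x))\<^sup>2)"
  define K where "K = (\<Sum>i<m. (cmod (\<Sum>x<n. of_real (a i x) * f x))\<^sup>2)"
  have "c * of_real N = (\<Sum>x<n. cnj (f x) * (c * f x))"
    by (simp add: N_def complex_norm_square sum_distrib_left mult_ac del: of_real_power)
  also have "\<dots> = (\<Sum>x<n. cnj (f x) * (\<Sum>y<n. \<Sum>i<m. of_real (a i x * a i y) * f y))"
    using eq by (intro sum.cong refl) (simp only: lessThan_iff)
  also have "\<dots> = (\<Sum>x<n. \<Sum>i<m. \<Sum>y<n. cnj (of_real (a i x) * f x) * (of_real (a i y) * f y))"
    by (subst sum.swap) (simp add: sum_distrib_left mult_ac)
  also have "\<dots> = (\<Sum>i<m. \<Sum>x<n. \<Sum>y<n. cnj (of_real (a i x) * f x) * (of_real (a i y) * f y))"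
    by (rule sum.swap)
  also have "\<dots> = of_real K"
    unfolding K_def of_real_sum complex_norm_square cnj_sum sum_product
    by (rule sum.cong[OF refl], subst sum.swap) (simp only: mult.commute)
  finally have cN: "c * of_real N = of_real K" .
  have "N \<noteq> 0"
  proof
    assume "N = 0"
    then have "\<forall>x<n. f x = 0" by (simp add: N_def sum_nonneg_eq_0_iff)
    then have "v = 0\<^sub>v n" using v(1) by (intro eq_vecI) (auto simp: f_def)
    with v(2) show False by simp
  qed
  moreover have "0 \<le> N" "0 \<le> K" by (auto simp: N_def K_def sum_nonneg)
  ultimately show ?thesis
    using cN by (intro exI[of _ "K / N"]) (auto simp: field_simps)
qed

text \<open>The polynomial splits over the complex numbers, its roots are real and nonnegative, and
  the factorization descends because the embedding of real into complex polynomials is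
  injective.\<close>

lemma char_poly_gram_splits:
  fixes A :: "real mat"
  assumes A: "A \<in> carrier_mat m n"
  obtains es where "char_poly (transpose_mat A * A) = (\<Prod>e\<leftarrow>es. [:- e, 1:])" "\<forall>e\<in>set es. 0 \<le> e"
proof -
  let ?G = "transpose_mat A * A"
  let ?C = "map_mat complex_of_real ?G"
  have G: "?G \<in> carrier_mat n n" using A by simp
  obtain cs where cs: "char_poly ?C = (\<Prod>c\<leftarrow>cs. [:- c, 1:])"
    using char_poly_factorized[of ?C n] G by auto
  have "\<exists>r\<ge>0. c = complex_of_real r" if "c \<in> set cs" for c
  proof -
    have "poly (char_poly ?C) c = 0"
      unfolding cs using that by (simp add: poly_prod_list prod_list_zero_iff image_iff)
    then have "eigenvalue ?C c"
      using eigenvalue_root_char_poly[of ?C n c] G by simp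
    then show ?thesis using gram_eigenvalue_real_nonneg[OF A] by simp
  qed
  then obtain r where r: "\<forall>c\<in>set cs. 0 \<le> r c \<and> c = complex_of_real (r c)"
    by metis
  define es where "es = map r cs"
  have "cs = map complex_of_real es"
    using r by (simp add: es_def map_idI)
  interpret of_real: map_poly_inj_comm_ring_hom complex_of_real ..
  have "map_poly complex_of_real (char_poly ?G) = char_poly ?C"
    by (rule of_real_hom.char_poly_hom[OF G, symmetric])
  also have "\<dots> = (\<Prod>e\<leftarrow>es. [:- complex_of_real e, 1:])"
    unfolding cs \<open>cs = map complex_of_real es\<close> by (simp add: comp_def)
  also have "\<dots> = map_poly complex_of_real (\<Prod>e\<leftarrow>es. [:- e, 1:])"
    by (induction es) (simp_all add: of_real.hom_mult del: mult_pCons_left)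
  finally have "char_poly ?G = (\<Prod>e\<leftarrow>es. [:- e, 1:])"
    by simp
  moreover have "\<forall>e\<in>set es. 0 \<le> e" using r by (auto simp: es_def)
  ultimately show ?thesis by (rule that)
qed

lemma proots_prod_list_linear: "proots (\<Prod>e\<leftarrow>es. [:- e, 1:]) = mset (es :: real list)"
proof (induction es)
  case (Cons e es)
  have "(\<Prod>e\<leftarrow>es. [:- e, 1:]) \<noteq> 0" by (auto simp: prod_list_zero_iff)
  then have "proots ([:- e, 1:] * (\<Prod>e\<leftarrow>es. [:- e, 1:])) = {#e#} + mset es"
    by (subst proots_mult) (auto simp: Cons)
  then show ?case by simp
qed simp

text \<open>Moving \<open>A\<close> through the powers and cyclicity of the trace give the equality.
  At \<open>j = 0\<close> the two traces would be \<open>m\<close> and \<open>n\<close>.\<close>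

lemma mat_trace_gram_transpose:
  fixes A :: "real mat"
  assumes A: "A \<in> carrier_mat m n" and j: "1 \<le> j"
  shows "mat_trace ((A * transpose_mat A) ^\<^sub>m j) = mat_trace ((transpose_mat A * A) ^\<^sub>m j)"
proof -
  let ?At = "transpose_mat A"
  obtain q where q: "j = Suc q" using j by (cases j) auto
  have At: "?At \<in> carrier_mat n m" using A by simp
  have push: "A * (?At * A) ^\<^sub>m i = (A * ?At) ^\<^sub>m i * A" for i
  proof (induction i)
    case (Suc i)
    have "A * (?At * A) ^\<^sub>m Suc i = A * (?At * A) ^\<^sub>m i * (?At * A)"
      using A by (simp add: assoc_mult_mat[of A m n _ n _ n])
    also have "\<dots> = (A * ?At) ^\<^sub>m i * (A * (?At * A))"
      unfolding Suc using A by (simp add: assoc_mult_mat[of _ m m _ n _ n])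
    also have "A * (?At * A) = A * ?At * A"
      using A At by (simp add: assoc_mult_mat[of A m n _ m _ n])
    also have "(A * ?At) ^\<^sub>m i * (A * ?At * A) = (A * ?At) ^\<^sub>m Suc i * A"
      using A At by (simp add: assoc_mult_mat[of _ m m _ m _ n])
    finally show ?case .
  qed (use A in simp)
  have "(A * ?At) ^\<^sub>m j = A * (?At * A) ^\<^sub>m q * ?At"
    unfolding push q using A At by (simp add: assoc_mult_mat[of _ m m _ n _ m])
  also have "mat_trace \<dots> = mat_trace (?At * (A * (?At * A) ^\<^sub>m q))"
    using A by (intro mat_trace_mult_comm[of _ m n]) auto
  also have "?At * (A * (?At * A) ^\<^sub>m q) = (?At * A) * (?At * A) ^\<^sub>m q"
    using A At by (simp add: assoc_mult_mat[of _ n m _ n _ n])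
  also have "mat_trace \<dots> = mat_trace ((?At * A) ^\<^sub>m q * (?At * A))"
    using A by (intro mat_trace_mult_comm[of _ n n]) auto
  also have "(?At * A) ^\<^sub>m q * (?At * A) = (?At * A) ^\<^sub>m j"
    by (simp add: q)
  finally show ?thesis .
qed

lemma schatten_norm_pow:
  assumes A: "A \<in> carrier_mat m n" and j: "1 \<le> j"
  shows "schatten_norm (2 * j) A ^ (2 * j) = mat_trace ((transpose_mat A * A) ^\<^sub>m j)"
proof -
  \<comment> \<open>Here \<open>X\<close> is \<open>A\<close> or its transpose, according to which
    Gram matrix \<open>singular_values\<close> uses.\<close>
  have *: "schatten_norm (2 * j) A ^ (2 * j) = mat_trace ((transpose_mat X * X) ^\<^sub>m j)"
    if X: "X \<in> carrier_mat m' n'"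
      and sv: "singular_values A = image_mset sqrt (proots (char_poly (transpose_mat X * X)))"
    for X m' n'
  proof -
    obtain es where es: "char_poly (transpose_mat X * X) = (\<Prod>e\<leftarrow>es. [:- e, 1:])" "\<forall>e\<in>set es. 0 \<le> e"
      using char_poly_gram_splits[OF X] .
    have "(\<Sum>\<sigma>\<in>#singular_values A. \<sigma> ^ (2 * j)) = (\<Sum>e\<leftarrow>es. sqrt e ^ (2 * j))"
      unfolding sv es(1) proots_prod_list_linear
      by (simp add: image_mset.compositionality comp_def sum_mset_sum_list flip: mset_map)
    also have "\<dots> = (\<Sum>e\<leftarrow>es. e ^ j)"
      using es(2) by (auto simp: power_mult intro!: arg_cong[of _ _ sum_list])
    finally have sum: "(\<Sum>\<sigma>\<in>#singular_values A. \<sigma> ^ (2 * j)) = (\<Sum>e\<leftarrow>es. e ^ j)" .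
    moreover have "0 \<le> (\<Sum>e\<leftarrow>es. e ^ j)"
      using es(2) by (intro sum_list_nonneg) auto
    ultimately have "schatten_norm (2 * j) A ^ (2 * j) = (\<Sum>e\<leftarrow>es. e ^ j)"
      using j by (simp add: schatten_norm_def)
    then show ?thesis
      using mat_trace_pow_char_poly_splits(2)[of "transpose_mat X * X" n' es j] X es(1) by simp
  qed
  show ?thesis
  proof (cases "n \<le> m")
    case True
    then show ?thesis using *[OF A] A by (simp add: singular_values_def)
  next
    case False
    have "transpose_mat A \<in> carrier_mat n m" using A by simp
    from *[OF this] False show ?thesis
      using A mat_trace_gram_transpose[OF A j] by (simp add: singular_values_def)
  qed
qed

section \<open>Pairs of subsets\<close>

text \<open>Such a set is determined by its parts inside and outside \<open>S\<close>, which are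
  chosen independently.\<close>

lemma card_subsets_meeting:
  fixes k p r :: nat
  assumes S: "S \<subseteq> {..<k}" "card S = p" and r: "r \<le> p"
  shows "card {S'. S' \<subseteq> {..<k} \<and> card S' = p \<and> card (S \<inter> S') = r} = (p choose r) * ((k - p) choose (p - r))"
proof -
  have fin: "finite S" using S finite_subset by blast
  have fin': "finite T" if "T \<subseteq> {..<k}" for T using that finite_subset by blast
  let ?A = "{R. R \<subseteq> S \<and> card R = r}" and ?B = "{Q. Q \<subseteq> {..<k} - S \<and> card Q = p - r}"
  have "bij_betw (\<lambda>(R, Q). R \<union> Q) (?A \<times> ?B)
      {S'. S' \<subseteq> {..<k} \<and> card S' = p \<and> card (S \<inter> S') = r}"
  proof (rule bij_betw_byWitness[where f' = "\<lambda>S'. (S \<inter> S', S' - S)"])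
    show "\<forall>a\<in>?A \<times> ?B. (\<lambda>S'. (S \<inter> S', S' - S)) ((\<lambda>(R, Q). R \<union> Q) a) = a"
      by auto
    show "\<forall>a'\<in>{S'. S' \<subseteq> {..<k} \<and> card S' = p \<and> card (S \<inter> S') = r}.
        (\<lambda>(R, Q). R \<union> Q) ((\<lambda>S'. (S \<inter> S', S' - S)) a') = a'"
      by auto
    show "(\<lambda>(R, Q). R \<union> Q) ` (?A \<times> ?B) \<subseteq>
        {S'. S' \<subseteq> {..<k} \<and> card S' = p \<and> card (S \<inter> S') = r}"
    proof (rule image_subsetI)
      fix a assume "a \<in> ?A \<times> ?B"
      then obtain R Q where a: "a = (R, Q)" and R: "R \<subseteq> S" "card R = r"
        and Q: "Q \<subseteq> {..<k} - S" "card Q = p - r"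
        by auto
      have "finite R" "finite Q" "R \<inter> Q = {}"
        using R Q S fin fin'[of Q] by (auto intro: finite_subset)
      then have "card (R \<union> Q) = p"
        using Q R r by (simp add: card_Un_disjoint)
      moreover have "S \<inter> (R \<union> Q) = R" using R Q by auto
      ultimately show "(\<lambda>(R, Q). R \<union> Q) a \<in> {S'. S' \<subseteq> {..<k} \<and> card S' = p \<and> card (S \<inter> S') = r}"
        using a R Q S by auto
    qed
    show "(\<lambda>S'. (S \<inter> S', S' - S)) ` {S'. S' \<subseteq> {..<k} \<and> card S' = p \<and> card (S \<inter> S') = r} \<subseteq> ?A \<times> ?B"
    proof (rule image_subsetI)
      fix S' assume "S' \<in> {S'. S' \<subseteq> {..<k} \<and> card S' = p \<and> card (S \<inter> S') = r}"
      then have S': "S' \<subseteq> {..<k}" "card S' = p" "card (S \<inter> S') = r" by auto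
      then have "card (S' - S) = p - r"
        using fin'[of S'] by (simp add: card_Diff_subset_Int Int_commute)
      with S' show "(S \<inter> S', S' - S) \<in> ?A \<times> ?B" by auto
    qed
  qed
  then have "card {S'. S' \<subseteq> {..<k} \<and> card S' = p \<and> card (S \<inter> S') = r} = card ?A * card ?B"
    unfolding card_cartesian_product[symmetric] by (rule bij_betw_same_card[symmetric])
  also have "card ?A = p choose r"
    using n_subsets[OF fin, of r] S by simp
  also have "card ?B = (k - p) choose (p - r)"
    using n_subsets[of "{..<k} - S" "p - r"] S fin by (simp add: card_Diff_subset)
  finally show ?thesis .
qed

text \<open>Both sides count the \<open>p\<close>-subsets of \<open>{..<k}\<close> together with a
  superset of size \<open>2 * p - r\<close>, the size of the union of two \<open>p\<close>-subsets
  with \<open>r\<close> common elements. If that size exceeds \<open>k\<close>, both sides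
  vanish.\<close>

lemma choose_overlap:
  fixes k p r :: nat
  assumes "r \<le> p" "p \<le> k"
  shows "(k choose p) * ((k - p) choose (p - r)) = (k choose (2 * p - r)) * ((2 * p - r) choose p)"
proof (cases "2 * p - r \<le> k")
  case True
  have "2 * p - r - p = p - r" by simp
  then show ?thesis
    using choose_mult[of p "2 * p - r" k] True assms by simp
next
  case False
  then show ?thesis using assms by (simp add: binomial_eq_0)
qed

lemma sum_pairs_of_subsets:
  fixes f :: "nat \<Rightarrow> real"
  assumes "p \<le> k"
  defines "\<S> \<equiv> {S. S \<subseteq> {..<k} \<and> card S = p}"
  shows "(\<Sum>S\<in>\<S>. \<Sum>S'\<in>\<S>. f (card (S \<inter> S'))) =
    (\<Sum>r\<le>p. real (k choose (2 * p - r)) * real ((2 * p - r) choose p) * real (p choose r) * f r)"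
proof -
  have fin: "finite \<S>" unfolding \<S>_def by (rule finite_subset[of _ "Pow {..<k}"]) auto
  have inner: "(\<Sum>S'\<in>\<S>. f (card (S \<inter> S'))) = (\<Sum>r\<le>p. real ((p choose r) * ((k - p) choose (p - r))) * f r)"
    if S: "S \<in> \<S>" for S
  proof -
    have "finite S" using S finite_subset unfolding \<S>_def by blast
    then have "(\<lambda>S'. card (S \<inter> S')) ` \<S> \<subseteq> {..p}"
      using S card_mono[of S] by (auto simp: \<S>_def)
    then have "(\<Sum>S'\<in>\<S>. f (card (S \<inter> S'))) = (\<Sum>r\<le>p. \<Sum>S'\<in>{S'\<in>\<S>. card (S \<inter> S') = r}. f (card (S \<inter> S')))"
      using fin by (intro sum.group[symmetric]) auto
    also have "\<dots> = (\<Sum>r\<le>p. real (card {S'\<in>\<S>. card (S \<inter> S') = r}) * f r)"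
      by (intro sum.cong refl) simp
    also have "\<dots> = (\<Sum>r\<le>p. real ((p choose r) * ((k - p) choose (p - r))) * f r)"
      using S card_subsets_meeting[of S k p] by (intro sum.cong refl) (simp add: \<S>_def conj_assoc)
    finally show ?thesis .
  qed
  have "(\<Sum>S\<in>\<S>. \<Sum>S'\<in>\<S>. f (card (S \<inter> S'))) =
      real (k choose p) * (\<Sum>r\<le>p. real ((p choose r) * ((k - p) choose (p - r))) * f r)"
    using inner n_subsets[of "{..<k}" p] by (simp add: \<S>_def)
  also have "\<dots> = (\<Sum>r\<le>p. real ((k choose p) * ((k - p) choose (p - r))) * real (p choose r) * f r)"
    by (simp add: sum_distrib_left mult_ac)
  also have "\<dots> = (\<Sum>r\<le>p. real (k choose (2 * p - r)) * real ((2 * p - r) choose p) * real (p choose r) * f r)"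
    using assms(1) by (intro sum.cong refl) (simp add: choose_overlap)
  finally show ?thesis .
qed

section \<open>The estimator as a sum over subsets of columns\<close>

context symmetric_kernel
begin

lemma kpow_eq_pow_mat:
  assumes B: "B \<in> carrier_mat n n" "\<And>x y. x < n \<Longrightarrow> y < n \<Longrightarrow> B $$ (x, y) = b x y"
    and "x < n" "y < n"
  shows "kpow j x y = (B ^\<^sub>m j) $$ (x, y)"
  using assms(3,4)
proof (induction j arbitrary: y)
  case 0
  then show ?case using B by simp
next
  case (Suc j)
  then show ?case using B by (simp add: scalar_prod_def atLeast0LessThan)
qed

lemma ktrace_eq_mat_trace:
  assumes "B \<in> carrier_mat n n" "\<And>x y. x < n \<Longrightarrow> y < n \<Longrightarrow> B $$ (x, y) = b x y"
  shows "ktrace j = mat_trace (B ^\<^sub>m j)"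
  using assms kpow_eq_pow_mat[OF assms] by (simp add: ktrace_def mat_trace_def)

definition subset_sum :: "(nat \<Rightarrow> nat \<Rightarrow> real) \<Rightarrow> nat \<Rightarrow> nat \<Rightarrow> nat \<Rightarrow> nat \<Rightarrow> real" where
  "subset_sum W q c x z = (\<Sum>S | S \<subseteq> {..<c} \<and> card S = q. sub_prod W S c x z)"

lemma sub_prod_cong: "S \<inter> {..<c} = S' \<inter> {..<c} \<Longrightarrow> sub_prod W S c x z = sub_prod W S' c x z"
proof (induction c arbitrary: z)
  case (Suc c)
  have "S \<inter> {..<c} = S' \<inter> {..<c}" "c \<in> S \<longleftrightarrow> c \<in> S'"
    using Suc.prems by (auto simp: set_eq_iff lessThan_Suc)
  then show ?case using Suc.IH by simp
qed simp

lemma subset_sum_0: "subset_sum W 0 c x z = of_bool (x = z \<and> x < n)"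
proof -
  have "{S. S \<subseteq> {..<c} \<and> card S = 0} = {{}}"
    by (auto dest: finite_subset)
  then show ?thesis by (simp add: subset_sum_def sub_prod_empty)
qed

lemma subset_sum_Suc_0: "subset_sum W (Suc q) 0 x z = 0"
proof -
  have "{S. S \<subseteq> {..<0::nat} \<and> card S = Suc q} = {}" by auto
  then show ?thesis unfolding subset_sum_def by (metis sum.empty)
qed

text \<open>A subset of \<open>{..<Suc c}\<close> either avoids \<open>c\<close> or arises from a
  smaller subset of \<open>{..<c}\<close> by adding \<open>c\<close>; the factor of column
  \<open>c\<close> then comes last in the product.\<close>

lemma subset_sum_Suc_Suc:
  "subset_sum W (Suc q) (Suc c) x z = subset_sum W (Suc q) c x z +
     (\<Sum>u<n. \<Sum>d<n. subset_sum W q c x u * (W u c * W d c * b d z))"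
proof -
  let ?A = "{S. S \<subseteq> {..<c} \<and> card S = Suc q}" and ?B = "{S. S \<subseteq> {..<c} \<and> card S = q}"
  have fin: "finite S" if "S \<subseteq> {..<c}" for S using that finite_subset by blast
  have finAB: "finite ?A" "finite ?B" by (rule finite_subset[of _ "Pow {..<c}"]; auto)+
  have "{S. S \<subseteq> {..<Suc c} \<and> card S = Suc q} = ?A \<union> insert c ` ?B"
  proof (rule Set.set_eqI, rule iffI)
    fix S assume "S \<in> {S. S \<subseteq> {..<Suc c} \<and> card S = Suc q}"
    then have S: "S \<subseteq> insert c {..<c}" "card S = Suc q" by (auto simp: lessThan_Suc)
    show "S \<in> ?A \<union> insert c ` ?B"
    proof (cases "c \<in> S")
      case True
      then have "S = insert c (S - {c})" "S - {c} \<in> ?B" using S by auto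
      then show ?thesis by blast
    qed (use S in auto)
  next
    fix S assume "S \<in> ?A \<union> insert c ` ?B"
    then show "S \<in> {S. S \<subseteq> {..<Suc c} \<and> card S = Suc q}"
      using fin by (auto simp: lessThan_Suc card_insert_if)
  qed
  moreover have "?A \<inter> insert c ` ?B = {}" by auto
  moreover have "inj_on (insert c) ?B" by (auto simp: inj_on_def)
  ultimately have "subset_sum W (Suc q) (Suc c) x z =
      (\<Sum>S\<in>?A. sub_prod W S (Suc c) x z) + (\<Sum>S\<in>?B. sub_prod W (insert c S) (Suc c) x z)"
    using finAB by (simp add: subset_sum_def sum.union_disjoint sum.reindex del: sub_prod.simps)
  also have "(\<Sum>S\<in>?A. sub_prod W S (Suc c) x z) = subset_sum W (Suc q) c x z"
    unfolding subset_sum_def by (intro sum.cong) auto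
  also have "(\<Sum>S\<in>?B. sub_prod W (insert c S) (Suc c) x z) =
      (\<Sum>S\<in>?B. \<Sum>u<n. \<Sum>d<n. sub_prod W S c x u * (W u c * W d c * b d z))"
  proof (intro sum.cong refl)
    fix S assume "S \<in> ?B"
    have "sub_prod W (insert c S) c x u = sub_prod W S c x u" for u
      by (rule sub_prod_cong) auto
    then show "sub_prod W (insert c S) (Suc c) x z =
        (\<Sum>u<n. \<Sum>d<n. sub_prod W S c x u * (W u c * W d c * b d z))"
      by simp
  qed
  also have "\<dots> = (\<Sum>u<n. \<Sum>S\<in>?B. \<Sum>d<n. sub_prod W S c x u * (W u c * W d c * b d z))"
    by (rule sum.swap)
  also have "\<dots> = (\<Sum>u<n. \<Sum>d<n. \<Sum>S\<in>?B. sub_prod W S c x u * (W u c * W d c * b d z))"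
    by (intro sum.cong refl sum.swap)
  also have "\<dots> = (\<Sum>u<n. \<Sum>d<n. subset_sum W q c x u * (W u c * W d c * b d z))"
    by (simp add: subset_sum_def sum_distrib_right)
  finally show ?thesis .
qed

text \<open>Row \<open>x\<close> of \<open>\<Omega> T\<^sup>q\<close> collects the open chains of length \<open>q + 1\<close> by their last column.\<close>

lemma subset_sum_eq_chain:
  fixes T :: "real mat"
  assumes T: "T \<in> carrier_mat k k"
    "\<And>i j. i < k \<Longrightarrow> j < k \<Longrightarrow> T $$ (i, j) = (if i < j then \<Sum>d<n. \<Sum>z<n. W d i * b d z * W z j else 0)"
    and "c \<le> k" "x < n"
  shows "subset_sum W (Suc q) c x z =
    (\<Sum>j<c. (\<Sum>i<k. W x i * (T ^\<^sub>m q) $$ (i, j)) * (\<Sum>d<n. W d j * b d z))"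
  using assms(3)
proof (induction q arbitrary: c z)
  case 0
  show ?case
    using 0
  proof (induction c)
    case (Suc c)
    have "(\<Sum>u<n. \<Sum>d<n. subset_sum W 0 c x u * (W u c * W d c * b d z)) =
        (\<Sum>u<n. if u = x then \<Sum>d<n. W u c * W d c * b d z else 0)"
      by (intro sum.cong refl) (auto simp: subset_sum_0)
    also have "\<dots> = W x c * (\<Sum>d<n. W d c * b d z)"
      using assms(4) by (simp add: sum_distrib_left mult.assoc)
    also have "W x c = (\<Sum>i<k. W x i * (T ^\<^sub>m 0) $$ (i, c))"
    proof -
      have "(\<Sum>i<k. W x i * (T ^\<^sub>m 0) $$ (i, c)) = (\<Sum>i<k. if i = c then W x c else 0)"
        using T(1) Suc.prems by (intro sum.cong refl) auto
      then show ?thesis using Suc.prems by simp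
    qed
    finally show ?case using Suc by (simp add: subset_sum_Suc_Suc)
  qed (simp add: subset_sum_Suc_0)
next
  case (Suc q)
  note IHq = Suc.IH
  show ?case
    using Suc.prems
  proof (induction c)
    case (Suc c)
    have col: "(\<Sum>u<n. subset_sum W (Suc q) c x u * W u c) = (\<Sum>i<k. W x i * (T ^\<^sub>m Suc q) $$ (i, c))"
    proof -
      have entry: "(T ^\<^sub>m Suc q) $$ (i, c) =
          (\<Sum>j<c. (T ^\<^sub>m q) $$ (i, j) * (\<Sum>d<n. \<Sum>u<n. W d j * b d u * W u c))" if "i < k" for i
      proof -
        have "(T ^\<^sub>m Suc q) $$ (i, c) = (\<Sum>j<k. (T ^\<^sub>m q) $$ (i, j) * T $$ (j, c))"
          using that T(1) Suc.prems by (simp add: scalar_prod_def atLeast0LessThan)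
        \<comment> \<open>Column \<open>c\<close> of \<open>T\<close> vanishes from row
          \<open>c\<close> on; this is what makes the column indices along a chain increase.\<close>
        also have "\<dots> = (\<Sum>j<c. (T ^\<^sub>m q) $$ (i, j) * T $$ (j, c))"
          using T(2) Suc.prems by (intro sum.mono_neutral_right) auto
        also have "\<dots> = (\<Sum>j<c. (T ^\<^sub>m q) $$ (i, j) * (\<Sum>d<n. \<Sum>u<n. W d j * b d u * W u c))"
          using T(2) Suc.prems by (intro sum.cong refl) auto
        finally show ?thesis .
      qed
      have "(\<Sum>u<n. subset_sum W (Suc q) c x u * W u c) =
          (\<Sum>u<n. \<Sum>j<c. (\<Sum>i<k. W x i * (T ^\<^sub>m q) $$ (i, j)) * ((\<Sum>d<n. W d j * b d u) * W u c))"
        using Suc.prems by (simp add: IHq sum_distrib_right mult.assoc)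
      also have "\<dots> = (\<Sum>j<c. \<Sum>u<n. (\<Sum>i<k. W x i * (T ^\<^sub>m q) $$ (i, j)) * ((\<Sum>d<n. W d j * b d u) * W u c))"
        by (rule sum.swap)
      also have "\<dots> = (\<Sum>j<c. (\<Sum>i<k. W x i * (T ^\<^sub>m q) $$ (i, j)) * (\<Sum>u<n. \<Sum>d<n. W d j * b d u * W u c))"
        by (simp add: sum_distrib_left[symmetric] sum_distrib_right[symmetric])
      also have "\<dots> = (\<Sum>j<c. \<Sum>i<k. W x i * ((T ^\<^sub>m q) $$ (i, j) * (\<Sum>d<n. \<Sum>u<n. W d j * b d u * W u c)))"
        by (subst (2) sum.swap) (simp only: sum_distrib_right mult.assoc)
      also have "\<dots> = (\<Sum>i<k. \<Sum>j<c. W x i * ((T ^\<^sub>m q) $$ (i, j) * (\<Sum>d<n. \<Sum>u<n. W d j * b d u * W u c)))"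
        by (rule sum.swap)
      also have "\<dots> = (\<Sum>i<k. W x i * (T ^\<^sub>m Suc q) $$ (i, c))"
        by (intro sum.cong refl) (simp only: entry sum_distrib_left lessThan_iff)
      finally show ?thesis .
    qed
    have "(\<Sum>u<n. \<Sum>d<n. subset_sum W (Suc q) c x u * (W u c * W d c * b d z)) =
        (\<Sum>u<n. subset_sum W (Suc q) c x u * W u c) * (\<Sum>d<n. W d c * b d z)"
      by (simp only: sum_product mult.assoc)
    then show ?case using Suc by (simp add: subset_sum_Suc_Suc col del: pow_mat.simps)
  qed (simp add: subset_sum_Suc_0)
qed

text \<open>Summation over \<open>x\<close> joins the last column \<open>j\<close> of a chain to its
  first column \<open>i\<close>, which produces the closing entry
  \<open>Z $$ (j, i)\<close>.\<close>

lemma mat_trace_chain_eq_subset_sum: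
  fixes T Z :: "real mat"
  assumes Z: "Z \<in> carrier_mat k k" "\<And>i j. i < k \<Longrightarrow> j < k \<Longrightarrow> Z $$ (i, j) = (\<Sum>d<n. \<Sum>z<n. W d i * b d z * W z j)"
  shows "mat_trace (strict_upper_part Z ^\<^sub>m q * Z) = (\<Sum>x<n. subset_sum W (Suc q) k x x)"
proof -
  define T where "T = strict_upper_part Z"
  have T: "T \<in> carrier_mat k k"
    "\<And>i j. i < k \<Longrightarrow> j < k \<Longrightarrow> T $$ (i, j) = (if i < j then \<Sum>d<n. \<Sum>z<n. W d i * b d z * W z j else 0)"
    using Z by (auto simp: T_def strict_upper_part_def)
  have "(\<Sum>x<n. subset_sum W (Suc q) k x x) =
      (\<Sum>x<n. \<Sum>j<k. \<Sum>i<k. (T ^\<^sub>m q) $$ (i, j) * (\<Sum>d<n. W d j * b d x * W x i))"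
    using subset_sum_eq_chain[OF T, of k _ q] by (simp add: sum_distrib_left sum_distrib_right mult_ac)
  also have "\<dots> = (\<Sum>j<k. \<Sum>x<n. \<Sum>i<k. (T ^\<^sub>m q) $$ (i, j) * (\<Sum>d<n. W d j * b d x * W x i))"
    by (rule sum.swap)
  also have "\<dots> = (\<Sum>j<k. \<Sum>i<k. \<Sum>x<n. (T ^\<^sub>m q) $$ (i, j) * (\<Sum>d<n. W d j * b d x * W x i))"
    by (intro sum.cong refl sum.swap)
  also have "\<dots> = (\<Sum>j<k. \<Sum>i<k. (T ^\<^sub>m q) $$ (i, j) * Z $$ (j, i))"
  proof (intro sum.cong refl)
    fix j i assume "j \<in> {..<k}" "i \<in> {..<k}"
    then have "Z $$ (j, i) = (\<Sum>x<n. \<Sum>d<n. W d j * b d x * W x i)"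
      using Z(2) by (subst sum.swap) auto
    then show "(\<Sum>x<n. (T ^\<^sub>m q) $$ (i, j) * (\<Sum>d<n. W d j * b d x * W x i)) = (T ^\<^sub>m q) $$ (i, j) * Z $$ (j, i)"
      by (simp add: sum_distrib_left)
  qed
  also have "\<dots> = (\<Sum>i<k. \<Sum>j<k. (T ^\<^sub>m q) $$ (i, j) * Z $$ (j, i))"
    by (rule sum.swap)
  also have "\<dots> = mat_trace (T ^\<^sub>m q * Z)"
    using Z(1) T(1) by (simp add: mat_trace_def scalar_prod_def atLeast0LessThan)
  finally show ?thesis by (simp add: T_def)
qed

end

section \<open>The variance bound\<close>

context gaussian_sketch
begin

text \<open>For overlaps 0 and 1 these are the exact means, for overlap 2 the value of
  \<open>pair_bound\<close>, and from 3 on its relaxation by \<open>bound_coeff\<close>.\<close>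

definition overlap_bound :: "nat \<Rightarrow> nat \<Rightarrow> real" where
  "overlap_bound p r =
     (if r = 0 then ktrace p ^ 2
      else if r = 1 then ktrace p ^ 2 + 2 * ktrace (2 * p)
      else if r = 2 then 6 * ktrace (2 * p) + 3 * ktrace 2 * ktrace (2 * p - 2)
      else (\<Sum>l=1..r. bound_coeff r l * (ktrace 2 ^ (l - 1) * ktrace (2 * p - 2 * (l - 1)))))"

lemma run_trace_le_overlap_bound:
  assumes "S \<subseteq> {..<k}" "card S = p" "S' \<subseteq> {..<k}" "card S' = p"
  shows "run_trace (form_id 0 0) (pair_word S S' k) \<le> overlap_bound p (card (S \<inter> S'))"
proof -
  define w where "w = pair_word S S' k"
  define r where "r = card (S \<inter> S')"
  have cnt: "cnt1 w = p" "cnt2 w = p" "cnt12 w = r"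
    using cnt_pair_word[OF assms(1,3)] assms by (auto simp: w_def r_def)
  have "r \<le> p"
    using cnt12_le(1)[of w] cnt by simp
  consider "r = 0" | "r = 1" | "2 \<le> r" by linarith
  then have "run_trace (form_id 0 0) w \<le> overlap_bound p r"
  proof cases
    case 1
    then show ?thesis
      using run_trace_id_disjoint[of w 0 0] cnt by (simp add: overlap_bound_def power2_eq_square)
  next
    case 2
    then show ?thesis
      using run_trace_id_one_common[of w 0 0] cnt
      by (simp add: overlap_bound_def power2_eq_square flip: mult_2)
  next
    case 3
    then have le: "run_trace (form_id 0 0) w \<le> pair_bound r (2 * p)"
      using run_trace_id_swap_le[of w 0 0] cnt by (simp flip: mult_2)
    show ?thesis
    proof (cases "r = 2")
      case True
      then show ?thesis using le by (simp add: overlap_bound_def pair_bound_2)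
    next
      case False
      then have "pair_bound r (2 * p) \<le> overlap_bound p r"
        using pair_bound_le[of r "2 * p"] 3 \<open>r \<le> p\<close> by (simp add: overlap_bound_def)
      then show ?thesis using le by simp
    qed
  qed
  then show ?thesis by (simp add: w_def r_def)
qed

text \<open>The mean is known exactly. The second moment expands over pairs of subsets, which are
  bounded one by one and then grouped by the size of their intersection.\<close>

lemma variance_sum_loops_le:
  assumes p: "1 \<le> p" "p \<le> k"
  shows "variance (\<lambda>\<omega>. \<Sum>S | S \<subseteq> {..<k} \<and> card S = p. loop S \<omega>) \<le>
    - ((real (k choose p) * ktrace p) ^ 2) +
    (\<Sum>r\<le>p. real (k choose (2 * p - r)) * real ((2 * p - r) choose p) * real (p choose r) * overlap_bound p r)"
proof -
  let ?\<S> = "{S. S \<subseteq> {..<k} \<and> card S = p}"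
  let ?X = "\<lambda>\<omega>. \<Sum>S\<in>?\<S>. loop S \<omega>"
  have mean: "has_bochner_integral M ?X (\<Sum>S\<in>?\<S>. ktrace (card S))"
    by (intro has_bochner_integral_sum has_bochner_integral_loop) auto
  have "(\<Sum>S\<in>?\<S>. ktrace (card S)) = real (k choose p) * ktrace p"
    using n_subsets[of "{..<k}" p] by simp
  with mean have EX: "integrable M ?X" "expectation ?X = real (k choose p) * ktrace p"
    by (simp_all add: has_bochner_integral_iff)
  have "has_bochner_integral M (\<lambda>\<omega>. \<Sum>S\<in>?\<S>. \<Sum>S'\<in>?\<S>. loop S \<omega> * loop S' \<omega>)
      (\<Sum>S\<in>?\<S>. \<Sum>S'\<in>?\<S>. run_trace (form_id 0 0) (pair_word S S' k))"
    by (intro has_bochner_integral_sum has_bochner_integral_loop_mult)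
  then have EX2: "integrable M (\<lambda>\<omega>. (?X \<omega>)\<^sup>2)"
    "expectation (\<lambda>\<omega>. (?X \<omega>)\<^sup>2) = (\<Sum>S\<in>?\<S>. \<Sum>S'\<in>?\<S>. run_trace (form_id 0 0) (pair_word S S' k))"
    by (simp_all add: has_bochner_integral_iff power2_eq_square sum_product)
  have "variance ?X = expectation (\<lambda>\<omega>. (?X \<omega>)\<^sup>2) - (expectation ?X)\<^sup>2"
    using EX(1) EX2(1) by (rule variance_eq)
  also have "expectation (\<lambda>\<omega>. (?X \<omega>)\<^sup>2) \<le> (\<Sum>S\<in>?\<S>. \<Sum>S'\<in>?\<S>. overlap_bound p (card (S \<inter> S')))"
    unfolding EX2(2) by (intro sum_mono run_trace_le_overlap_bound) auto
  also have "\<dots> = (\<Sum>r\<le>p. real (k choose (2 * p - r)) * real ((2 * p - r) choose p) * real (p choose r) * overlap_bound p r)"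
    by (rule sum_pairs_of_subsets[OF p(2)])
  finally show ?thesis by (simp add: EX(2))
qed

lemma sum_overlap_bound:
  assumes p: "1 \<le> p"
  defines "N \<equiv> \<lambda>r. real (k choose (2 * p - r)) * real ((2 * p - r) choose p) * real (p choose r)"
  shows "(\<Sum>r\<le>p. N r * overlap_bound p r) =
    N 0 * ktrace p ^ 2 + N 1 * (ktrace p ^ 2 + 2 * ktrace (2 * p)) +
    N 2 * (6 * ktrace (2 * p) + 3 * ktrace 2 * ktrace (2 * p - 2)) +
    (\<Sum>r=3..p. N r * (\<Sum>l=1..r. bound_coeff r l * (ktrace 2 ^ (l - 1) * ktrace (2 * p - 2 * (l - 1)))))"
proof -
  \<comment> \<open>If \<open>p = 1\<close>, the index \<open>r = 2\<close> is new on the right, but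
    \<open>p choose r\<close> is zero there.\<close>
  have "(\<Sum>r\<le>p. N r * overlap_bound p r) = (\<Sum>r\<in>{0,1,2} \<union> {3..p}. N r * overlap_bound p r)"
    using p by (intro sum.mono_neutral_left) (auto simp: N_def)
  also have "\<dots> = (\<Sum>r\<in>{0,1,2}. N r * overlap_bound p r) + (\<Sum>r=3..p. N r * overlap_bound p r)"
    by (intro sum.union_disjoint) auto
  also have "(\<Sum>r=3..p. N r * overlap_bound p r) =
      (\<Sum>r=3..p. N r * (\<Sum>l=1..r. bound_coeff r l * (ktrace 2 ^ (l - 1) * ktrace (2 * p - 2 * (l - 1)))))"
    by (intro sum.cong refl) (auto simp: overlap_bound_def)
  finally show ?thesis by (simp add: overlap_bound_def)
qed

end

lemma sketch_gram_index:
  assumes A: "A \<in> carrier_mat m n" and W: "W \<in> carrier_mat n k" and "i < k" "j < k"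
  shows "sketch_gram A W $$ (i, j) =
    (\<Sum>d<n. \<Sum>z<n. W $$ (d, i) * (transpose_mat A * A) $$ (d, z) * W $$ (z, j))"
proof -
  have "sketch_gram A W = transpose_mat W * ((transpose_mat A * A) * W)"
    using A W unfolding sketch_gram_def
    by (simp add: transpose_mult[OF A W] assoc_mult_mat[of _ k n _ m _ k] assoc_mult_mat[of _ n m _ n _ k])
  moreover have "(transpose_mat W * (G * W)) $$ (i, j) = (\<Sum>d<n. \<Sum>z<n. W $$ (d, i) * G $$ (d, z) * W $$ (z, j))"
    if "G \<in> carrier_mat n n" for G
    using that W assms(3,4) by (simp add: scalar_prod_def atLeast0LessThan sum_distrib_left mult.assoc)
  moreover have "transpose_mat A * A \<in> carrier_mat n n" using A by simp
  ultimately show ?thesis by simp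
qed

theorem theorem3:
  fixes A :: "real mat" and m n k p :: nat
    and M :: "'a measure" and \<Omega> :: "'a \<Rightarrow> real mat"
  assumes A: "A \<in> carrier_mat m n"
    and p: "1 \<le> p" "p \<le> k"
    and M: "prob_space M"
    and \<Omega>: "std_gaussian_mat M n k \<Omega>"
  shows
    "prob_space.variance M (\<lambda>\<omega>. real (k choose p) * schatten_estimator A p (\<Omega> \<omega>)) \<le>
       - (real (k choose p))\<^sup>2 * schatten_norm (2 * p) A ^ (4 * p)
       + real (k choose (2 * p)) * real ((2 * p) choose p) * schatten_norm (2 * p) A ^ (4 * p)
       + real (k choose (2 * p - 1)) * real ((2 * p - 1) choose p) * real p *
           (schatten_norm (2 * p) A ^ (4 * p) + 2 * schatten_norm (4 * p) A ^ (4 * p))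
       + real (k choose (2 * p - 2)) * real ((2 * p - 2) choose p) * real (p choose 2) *
           (6 * schatten_norm (4 * p) A ^ (4 * p)
            + 3 * schatten_norm 4 A ^ 4 * schatten_norm (4 * p - 4) A ^ (4 * p - 4))
       + (\<Sum>r=3..p. real (k choose (2 * p - r)) * real ((2 * p - r) choose p) * real (p choose r) *
           (\<Sum>l=1..r. bound_coeff r l * schatten_norm 4 A ^ (4 * (l - 1)) *
              schatten_norm (4 * p - 4 * (l - 1)) A ^ (4 * p - 4 * (l - 1))))"
proof -
  define B where "B = transpose_mat A * A"
  define b where "b x y = (if x < n \<and> y < n then B $$ (x, y) else 0)" for x y
  have B: "B \<in> carrier_mat n n" using A by (simp add: B_def)
  have B_sym: "B $$ (x, y) = B $$ (y, x)" if "x < n" "y < n" for x y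
  proof -
    have "transpose_mat B = B"
      using A by (simp add: B_def transpose_mult[of _ n m _ n])
    then show ?thesis using that B by (metis carrier_matD index_transpose_mat(1))
  qed
  interpret symmetric_kernel n b
    using B_sym by unfold_locales (auto simp: b_def)
  obtain es where es: "char_poly B = (\<Prod>e\<leftarrow>es. [:- e, 1:])" "\<forall>e\<in>set es. 0 \<le> e"
    using char_poly_gram_splits[OF A] unfolding B_def .
  \<comment> \<open>The value 0 beyond the list of eigenvalues keeps \<open>\<mu>\<close>
    nonnegative at every index, as \<open>psd_kernel\<close> demands.\<close>
  define \<mu> where "\<mu> i = (if i < n then es ! i else 0)" for i
  have trace: "ktrace j = mat_trace (B ^\<^sub>m j)" for j
    by (rule ktrace_eq_mat_trace[OF B]) (simp add: b_def)
  have len: "length es = n"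
    by (rule mat_trace_pow_char_poly_splits(1)[OF B es(1)])
  have "psd_kernel_axioms n b \<mu>"
  proof
    show "0 \<le> \<mu> i" for i
      using es(2) len by (simp add: \<mu>_def)
    have "(\<Sum>e\<leftarrow>es. e ^ j) = (\<Sum>i<n. \<mu> i ^ j)" for j
      using len by (simp add: \<mu>_def sum_list_sum_nth atLeast0LessThan)
    then show "ktrace j = (\<Sum>i<n. \<mu> i ^ j)" for j
      unfolding trace using mat_trace_pow_char_poly_splits(2)[OF B es(1)] by simp
  qed
  then interpret gaussian_sketch n b \<mu> M k \<Omega>
    using M \<Omega> symmetric_kernel_axioms
    by (intro gaussian_sketch.intro psd_kernel.intro gaussian_sketch_axioms.intro)

  have norm: "schatten_norm (2 * j) A ^ (2 * j) = ktrace j" if "1 \<le> j" for j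
    using schatten_norm_pow[OF A that] by (simp add: trace B_def)
  have norm_2p: "schatten_norm (2 * p) A ^ (4 * p) = ktrace p ^ 2"
    unfolding norm[OF p(1), symmetric] power_mult[symmetric] by (simp add: mult.commute)
  have norm_4p: "schatten_norm (4 * p) A ^ (4 * p) = ktrace (2 * p)"
    using norm[of "2 * p"] p by simp
  have norm_4: "schatten_norm 4 A ^ (4 * l) = ktrace 2 ^ l" for l
    using norm[of 2] by (simp add: power_mult)
  \<comment> \<open>The condition \<open>l < p\<close> keeps the order of the norm positive; it
    holds for \<open>l - 1\<close> whenever \<open>1 \<le> l\<close> and
    \<open>l \<le> r \<le> p\<close>.\<close>
  have norm_diff: "schatten_norm (4 * p - 4 * l) A ^ (4 * p - 4 * l) = ktrace (2 * p - 2 * l)" if "l < p" for l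
    using norm[of "2 * p - 2 * l"] that by (simp add: diff_mult_distrib2)

  have X: "real (k choose p) * schatten_estimator A p (\<Omega> \<omega>) =
      (\<Sum>S | S \<subseteq> {..<k} \<and> card S = p. loop S \<omega>)" if "\<omega> \<in> space M" for \<omega>
  proof -
    have W: "\<Omega> \<omega> \<in> carrier_mat n k"
      using that \<Omega> by (simp add: std_gaussian_mat_def)
    let ?Z = "sketch_gram A (\<Omega> \<omega>)"
    have Z: "?Z \<in> carrier_mat k k"
      unfolding sketch_gram_def using A W by (intro mult_carrier_mat[of _ k m]) auto
    have "real (k choose p) * schatten_estimator A p (\<Omega> \<omega>) = mat_trace (strict_upper_part ?Z ^\<^sub>m (p - 1) * ?Z)"
      using W p by (simp add: schatten_estimator_def Let_def)
    also have "\<dots> = (\<Sum>x<n. subset_sum (entry \<omega>) (Suc (p - 1)) k x x)"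
      using Z sketch_gram_index[OF A W]
      by (intro mat_trace_chain_eq_subset_sum) (auto simp: entry_def b_def B_def)
    also have "\<dots> = (\<Sum>S | S \<subseteq> {..<k} \<and> card S = p. loop S \<omega>)"
      using p by (simp add: subset_sum_def loop_def) (rule sum.swap)
    finally show ?thesis .
  qed
  have "variance (\<lambda>\<omega>. real (k choose p) * schatten_estimator A p (\<Omega> \<omega>)) =
      variance (\<lambda>\<omega>. \<Sum>S | S \<subseteq> {..<k} \<and> card S = p. loop S \<omega>)"
  proof -
    \<comment> \<open>The two random variables are known to agree on \<open>space M\<close> only, so
      the means are identified first and then the integrals of the squared deviations.\<close>
    have E: "expectation (\<lambda>\<omega>. real (k choose p) * schatten_estimator A p (\<Omega> \<omega>)) =
        expectation (\<lambda>\<omega>. \<Sum>S | S \<subseteq> {..<k} \<and> card S = p. loop S \<omega>)"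
      by (rule Bochner_Integration.integral_cong[OF refl X])
    show ?thesis
      unfolding E by (rule Bochner_Integration.integral_cong[OF refl]) (simp only: X)
  qed
  also note variance_sum_loops_le[OF p]
  also note sum_overlap_bound[OF p(1)]
  also have "(\<Sum>r=3..p. real (k choose (2 * p - r)) * real ((2 * p - r) choose p) * real (p choose r) *
        (\<Sum>l=1..r. bound_coeff r l * (ktrace 2 ^ (l - 1) * ktrace (2 * p - 2 * (l - 1))))) =
      (\<Sum>r=3..p. real (k choose (2 * p - r)) * real ((2 * p - r) choose p) * real (p choose r) *
        (\<Sum>l=1..r. bound_coeff r l * schatten_norm 4 A ^ (4 * (l - 1)) *
              schatten_norm (4 * p - 4 * (l - 1)) A ^ (4 * p - 4 * (l - 1))))"
    unfolding mult.assoc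
    by (intro sum.cong refl arg_cong2[where f = "(*)"]) (auto simp: norm_4 norm_diff)
  also have "real (k choose (2 * p - 2)) * real ((2 * p - 2) choose p) * real (p choose 2) *
      (6 * ktrace (2 * p) + 3 * ktrace 2 * ktrace (2 * p - 2)) =
    real (k choose (2 * p - 2)) * real ((2 * p - 2) choose p) * real (p choose 2) *
      (6 * schatten_norm (4 * p) A ^ (4 * p)
            + 3 * schatten_norm 4 A ^ 4 * schatten_norm (4 * p - 4) A ^ (4 * p - 4))"
  \<comment> \<open>For \<open>p = 1\<close> the last norm has order 0, where
    \<open>norm_diff\<close> says nothing, but the factor \<open>p choose 2\<close> is zero.\<close>
  proof (cases "p = 1")
    case False
    then show ?thesis
      using p norm_diff[of 1] norm_4[of 1] by (simp add: norm_4p)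
  qed simp
  finally show ?thesis
    unfolding norm_2p norm_4p by (simp add: power_mult_distrib algebra_simps)
qed

end
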